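(* For every positive integer $n$, $$|D_c(n)|=|D(n)|-\sum_{\substack{n\le N<2(n-1)\\ N \text{ even}}}\ \sum_{k=1}^{n-1}|P(N-k-n+1,\,k-1,\,n-1,\,n-k-1)|.$$ Moreover, there is an algorithm which, given a positive integer $n$ and the value $|D(n)|$, computes $|D_c(n)|$ in time $O(n^3)$ and space $O(n^3)$.
   Context: All graphs are finite, simple (no loops or multiple edges) and undirected. Degree sequences are unordered (i.e. regarded as multisets, written in non-increasing order). $D(n)$ is the set of zero-free degree sequences of length $n$: those sequences $d_1\ge d_2\ge\dots\ge d_n\ge 1$ of positive integers that are the vertex degrees of some graph on $n$ vertices. $D_c(n)$ is the subset of $D(n)$ consisting of the potentially connected sequences, i.e. those that are the degree sequence of at least one connected graph on $n$ vertices. A partition of an integer $N\ge 0$ is a non-increasing sequence of positive integers (parts) with sum $N$ (the empty partition is the only partition of $0$). For a partition $\pi$, $\pi_i$ and $\pi_i'$ denote the number of dots in the $i$-th row and the $i$-th column of its Ferrers diagram (so $\pi_i$ is the $i$-th part and $\pi'$ is the conjugate partition), $d(\pi)$ is the size (number of rows) of its Durfee square, i.e. of the largest upper-left square contained in its Ferrers diagram, and $r_i(\pi)=\pi_i'-\pi_i$ for $1\le i\le d(\pi)$. $P(N,k,l)$ is the set of partitions of $N$ into at most $l$ parts with largest part at most $k$ (empty if $N<0$, $k<0$ or $l<0$). For an integer $s$, $P(N,k,l,s)=\emptyset$ if $s<0$, and if $s\ge 0$, $$P(N,k,l,s)=\Big\{\pi\in P(N,k,l) : s+\sum_{i=1}^{j}r_i(\pi)\ge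 j \text{ for all } 1\le j\le d(\pi)\Big\}.$$ Cost model: time is the number of elementary operations (additions, subtractions and comparisons of integers, array accesses), each of unit cost; space is the number of integers stored. *)

theory Defs
  imports
    "Graph_Theory.Graph_Theory"
    "HOL-Library.Multiset"
    "HOL-Library.Landau_Symbols"
begin

section \<open>Degree sequences\<close>

text \<open>
  A finite simple undirected graph is a \<^locale>\<open>pair_graph\<close>: a finite, loop-free, symmetric
  digraph without parallel arcs.  An edge is a pair of opposite arcs, so the degree of a vertex
  is its out-degree.  Vertices may be taken to be natural numbers without loss of generality.
\<close>

definition degree_mset :: "nat pair_pre_digraph \<Rightarrow> nat multiset" where
  "degree_mset G = image_mset (out_degree (with_proj G)) (mset_set (pverts G))"

definition realizes :: "nat pair_pre_digraph \<Rightarrow> nat list \<Rightarrow> bool" where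
  "realizes G ds \<longleftrightarrow> pair_graph G \<and> card (pverts G) = length ds \<and> degree_mset G = mset ds"

definition D :: "nat \<Rightarrow> nat list set" where
  "D n = {ds. length ds = n \<and> sorted_wrt (\<ge>) ds \<and> (\<forall>d\<in>set ds. 1 \<le> d) \<and> (\<exists>G. realizes G ds)}"

definition Dc :: "nat \<Rightarrow> nat list set" where
  "Dc n = {ds \<in> D n. \<exists>G. realizes G ds \<and> Digraph_Component.connected (with_proj G)}"


section \<open>Partitions\<close>

definition is_partition :: "int \<Rightarrow> nat list \<Rightarrow> bool" where
  "is_partition N p \<longleftrightarrow> sorted_wrt (\<ge>) p \<and> (\<forall>x\<in>set p. 1 \<le> x) \<and> int (sum_list p) = N"

text \<open>Rows and columns are numbered from 1, list positions from 0.\<close>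

definition ferrers :: "nat list \<Rightarrow> (nat \<times> nat) set" where
  "ferrers p = {(i, j). 1 \<le> i \<and> i \<le> length p \<and> 1 \<le> j \<and> j \<le> p ! (i - 1)}"

definition row :: "nat list \<Rightarrow> nat \<Rightarrow> nat" where
  "row p i = card {j. (i, j) \<in> ferrers p}"

definition col :: "nat list \<Rightarrow> nat \<Rightarrow> nat" where
  "col p j = card {i. (i, j) \<in> ferrers p}"

definition durfee :: "nat list \<Rightarrow> nat" where
  "durfee p = Max {m. {1..m} \<times> {1..m} \<subseteq> ferrers p}"

definition r :: "nat list \<Rightarrow> nat \<Rightarrow> int" where
  "r p i = int (col p i) - int (row p i)"

text \<open>
  The empty partition has largest part 0, so it belongs to \<open>P3 0 k l\<close> exactly when
  \<open>k \<ge> 0\<close> and \<open>l \<ge> 0\<close>.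
\<close>

definition P3 :: "int \<Rightarrow> int \<Rightarrow> int \<Rightarrow> nat list set" where
  "P3 N k l = {p. 0 \<le> k \<and> 0 \<le> l \<and> is_partition N p \<and> int (length p) \<le> l \<and> (\<forall>x\<in>set p. int x \<le> k)}"

definition P4 :: "int \<Rightarrow> int \<Rightarrow> int \<Rightarrow> int \<Rightarrow> nat list set" where
  "P4 N k l s =
     (if s < 0 then {}
      else {p \<in> P3 N k l. \<forall>j\<in>{1..durfee p}. s + (\<Sum>i=1..j. r p i) \<ge> int j})"


section \<open>Cost model\<close>

text \<open>
  A program is a fixed finite text in a small imperative language over unbounded integers, with
  named scalar variables and named one-dimensional arrays.  Every executed assignment, addition,
  subtraction, array access and comparison (including every evaluation of a loop guard) costs one
  unit of time.  There is no multiplication.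

  The memory is a partial map: a cell has no content before it is first written, and reading such a
  cell (or using a negative index) blocks the execution.  An array entry may be written only if all
  entries of smaller index have been written, so arrays are stored contiguously from index 0
  and cannot act as sparse dictionaries.
\<close>

datatype cell = Scalar string | Elem string nat

type_synonym mem = "cell \<Rightarrow> int option"

datatype operand = Const int | Var string

datatype test = Less operand operand | LessEq operand operand | Equal operand operand

datatype com =
    Skip
  | Copy string operand
  | Add string operand operand
  | Sub string operand operand
  | Load string string operand
  | Store string operand operand
  | Seq com com
  | Cond test com com
  | While test com

fun opval :: "mem \<Rightarrow> operand \<Rightarrow> int option" where
  "opval m (Const c) = Some c"
| "opval m (Var x) = m (Scalar x)"

inductive testval :: "mem \<Rightarrow> test \<Rightarrow> bool \<Rightarrow> bool" for m where
  "opval m a = Some u \<Longrightarrow> opval m b = Some v \<Longrightarrow> testval m (Less a b) (u < v)"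
| "opval m a = Some u \<Longrightarrow> opval m b = Some v \<Longrightarrow> testval m (LessEq a b) (u \<le> v)"
| "opval m a = Some u \<Longrightarrow> opval m b = Some v \<Longrightarrow> testval m (Equal a b) (u = v)"

text \<open>
  \<open>exec c m t m'\<close>: started in memory \<open>m\<close>, program \<open>c\<close> terminates after time \<open>t\<close> in memory \<open>m'\<close>.
  \<open>Load x A i\<close> is \<open>x := A[i]\<close>, and \<open>Store A i a\<close> is \<open>A[i] := a\<close>.
\<close>

inductive exec :: "com \<Rightarrow> mem \<Rightarrow> nat \<Rightarrow> mem \<Rightarrow> bool" where
  Skip: "exec Skip m 1 m"
| Copy: "opval m a = Some u \<Longrightarrow> exec (Copy x a) m 1 (m(Scalar x \<mapsto> u))"
| Add: "opval m a = Some u \<Longrightarrow> opval m b = Some v \<Longrightarrow>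
    exec (Add x a b) m 1 (m(Scalar x \<mapsto> u + v))"
| Sub: "opval m a = Some u \<Longrightarrow> opval m b = Some v \<Longrightarrow>
    exec (Sub x a b) m 1 (m(Scalar x \<mapsto> u - v))"
| Load: "opval m i = Some u \<Longrightarrow> 0 \<le> u \<Longrightarrow> m (Elem A (nat u)) = Some v \<Longrightarrow>
    exec (Load x A i) m 1 (m(Scalar x \<mapsto> v))"
| Store: "opval m i = Some u \<Longrightarrow> 0 \<le> u \<Longrightarrow> (\<forall>j<nat u. m (Elem A j) \<noteq> None) \<Longrightarrow>
    opval m a = Some v \<Longrightarrow> exec (Store A i a) m 1 (m(Elem A (nat u) \<mapsto> v))"
| Seq: "exec c1 m t1 m1 \<Longrightarrow> exec c2 m1 t2 m2 \<Longrightarrow> exec (Seq c1 c2) m (t1 + t2) m2"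
| CondTrue: "testval m b True \<Longrightarrow> exec c1 m t m' \<Longrightarrow> exec (Cond b c1 c2) m (1 + t) m'"
| CondFalse: "testval m b False \<Longrightarrow> exec c2 m t m' \<Longrightarrow> exec (Cond b c1 c2) m (1 + t) m'"
| WhileFalse: "testval m b False \<Longrightarrow> exec (While b c) m 1 m"
| WhileTrue: "testval m b True \<Longrightarrow> exec c m t1 m1 \<Longrightarrow> exec (While b c) m1 t2 m2 \<Longrightarrow>
    exec (While b c) m (1 + t1 + t2) m2"

inductive_cases testvalE: "testval m b v"

lemma testval_det: "testval m b v \<Longrightarrow> testval m b v' \<Longrightarrow> v = v'"
  by (cases b) (auto elim!: testvalE)

inductive_cases SkipE: "exec Skip m t m'"
inductive_cases CopyE: "exec (Copy x a) m t m'"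
inductive_cases AddE: "exec (Add x a b) m t m'"
inductive_cases SubE: "exec (Sub x a b) m t m'"
inductive_cases LoadE: "exec (Load x A i) m t m'"
inductive_cases StoreE: "exec (Store A i a) m t m'"
inductive_cases SeqE: "exec (Seq c1 c2) m t m'"
inductive_cases CondE: "exec (Cond b c1 c2) m t m'"
inductive_cases WhileE: "exec (While b c) m t m'"

lemma exec_det: "exec c m t m' \<Longrightarrow> exec c m s m'' \<Longrightarrow> s = t \<and> m'' = m'"
proof (induction arbitrary: s m'' rule: exec.induct)
  case (Seq c1 m t1 m1 c2 t2 m2)
  from Seq.prems show ?case
  proof (rule SeqE)
    fix s1 k s2
    assume *: "s = s1 + s2" "exec c1 m s1 k" "exec c2 k s2 m''"
    from Seq.IH(1)[OF *(2)] have "s1 = t1" "k = m1" by auto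
    with Seq.IH(2)[of s2 m''] * show ?thesis by simp
  qed
next
  case (CondTrue m b c1 t m' c2)
  from CondTrue.prems show ?case
    by (rule CondE) (auto dest: CondTrue.IH testval_det[OF CondTrue.hyps(1)])
next
  case (CondFalse m b c2 t m' c1)
  from CondFalse.prems show ?case
    by (rule CondE) (auto dest: CondFalse.IH testval_det[OF CondFalse.hyps(1)])
next
  case (WhileFalse m b c)
  from WhileFalse.prems show ?case
    by (rule WhileE) (auto dest: testval_det[OF WhileFalse.hyps(1)])
next
  case (WhileTrue m b c t1 m1 t2 m2)
  from WhileTrue.prems show ?case
  proof (rule WhileE)
    assume "testval m b False"
    with testval_det[OF WhileTrue.hyps(1)] show ?thesis by blast
  next
    fix s1 k s2
    assume *: "s = Suc (s1 + s2)" "exec c m s1 k" "exec (While b c) k s2 m''"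
    from WhileTrue.IH(1)[OF *(2)] have "s1 = t1" "k = m1" by auto
    with WhileTrue.IH(2)[of s2 m''] * show ?thesis by simp
  qed
qed (erule SkipE CopyE AddE SubE LoadE StoreE, simp)+

text \<open>
  Cells are never released, so the integers stored at the end of a run are all those ever stored.
\<close>

lemma exec_dom: "exec c m t m' \<Longrightarrow> dom m \<subseteq> dom m' \<and> (finite (dom m) \<longrightarrow> finite (dom m'))"
  by (induction rule: exec.induct) (auto simp del: fun_upd_apply)

text \<open>
  The scalar \<open>result\<close> holds the output.  The space \<open>s\<close> includes the input cells.
\<close>

definition computes :: "com \<Rightarrow> mem \<Rightarrow> int \<Rightarrow> nat \<Rightarrow> nat \<Rightarrow> bool" where
  "computes c m v t s \<longleftrightarrow>
     (\<exists>m'. exec c m t m' \<and> m' (Scalar ''result'') = Some v \<and> s = card (dom m'))"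

definition input :: "nat \<Rightarrow> nat \<Rightarrow> mem" where
  "input n d = [Scalar ''n'' \<mapsto> int n, Scalar ''d'' \<mapsto> int d]"

end

theory Submission
  imports Defs
begin

text \<open>
  Let \<open>n\<close> be positive. A connected graph on \<open>n\<close> vertices has at least \<open>n - 1\<close> edges, so a degree sequence
  with sum below \<open>2 * (n - 1)\<close> has no connected realization (\<open>connected_on_card_arcs\<close>). Conversely, a
  realization without isolated vertices and with at least \<open>n - 1\<close> edges that is disconnected contains a
  cycle (\<open>cycle_arc_exists\<close>), and switching a cycle edge with an edge of another component keeps all
  degrees and merges components; repeating this gives a connected realization
  (\<open>connected_realization\<close>). Hence \<open>Dc n\<close> misses exactly the members of \<open>D n\<close> with sum below
  \<open>2 * (n - 1)\<close>.

  In that range, every sequence of positive integers with even sum is a degree sequence: it is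
  realized by a forest (\<open>graphical_of_small_sum\<close>). So the missing sequences of sum \<open>N\<close> are all
  sequences of \<open>n\<close> positive integers with sum \<open>N\<close>, and subtracting 1 from each entry turns them into the
  partitions of \<open>m = N - n\<close>. Here \<open>m \<le> n - 4\<close>, so having at most \<open>n\<close> parts is no restriction
  (\<open>card_sparse_seqs\<close>).

  The inner sum of the formula counts the same partitions by their largest part \<open>k - 1\<close>. What remains
  after removing that part is so small compared with \<open>n - k - 1\<close> that the inequalities on its
  Ferrers diagram follow (\<open>P4_eq_P3\<close>), and the sum collapses to the number of partitions of \<open>m\<close>
  (\<open>sum_card_P4\<close>).

  The number to be subtracted from \<open>card (D n)\<close> is therefore the sum of the partition numbers
  of \<open>n - 4, n - 6, \<dots>\<close>. The classical table of partitions into parts of bounded size computes it in time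
  \<open>O(n\<^sup>2)\<close> and space \<open>O(n)\<close> (\<open>runs_program\<close>), well within the claimed bounds.
\<close>

section \<open>Graphs as symmetric relations\<close>


definition simple_graph :: "'a set \<Rightarrow> ('a \<times> 'a) set \<Rightarrow> bool" where
  "simple_graph V E \<longleftrightarrow> finite V \<and> E \<subseteq> V \<times> V \<and> sym E \<and> irrefl E"

text \<open>
  On a symmetric relation an undirected edge counts as two arcs, so \<open>card E\<close> below is always twice
  the number of edges and equals the sum of the degrees.
\<close>

definition deg :: "('a \<times> 'a) set \<Rightarrow> 'a \<Rightarrow> nat" where
  "deg E v = card (E `` {v})"

definition connected_on :: "'a set \<Rightarrow> ('a \<times> 'a) set \<Rightarrow> bool" where
  "connected_on V E \<longleftrightarrow> V \<noteq> {} \<and> V \<times> V \<subseteq> E\<^sup>*"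

lemma simple_graph_finite_arcs: "simple_graph V E \<Longrightarrow> finite E"
  unfolding simple_graph_def by (meson finite_SigmaI finite_subset)

lemma pair_graph_iff_simple_graph: "pair_graph G \<longleftrightarrow> simple_graph (pverts G) (parcs G)"
proof
  assume "pair_graph G"
  then interpret pair_graph G .
  show "simple_graph (pverts G) (parcs G)"
    unfolding simple_graph_def
    using pair_finite_verts sym_arcs by (auto simp: symmetric_def wellformed' irrefl_def dest: no_loops')
next
  assume "simple_graph (pverts G) (parcs G)"
  then have *: "finite (parcs G)" "finite (pverts G)" "parcs G \<subseteq> pverts G \<times> pverts G"
      "sym (parcs G)" "irrefl (parcs G)"
    using simple_graph_finite_arcs by (auto simp: simple_graph_def)
  show "pair_graph G"
    by unfold_locales (use * in \<open>auto simp: symmetric_def irrefl_def\<close>)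
qed

lemma out_degree_with_proj: "out_degree (with_proj G) v = deg (parcs G) v"
proof -
  have "out_arcs (with_proj G) v = Pair v ` (parcs G `` {v})"
    by (auto simp: out_arcs_def)
  then show ?thesis
    by (simp add: out_degree_def deg_def card_image inj_on_def)
qed

lemma connected_iff_connected_on:
  assumes "simple_graph (pverts G) (parcs G)"
  shows "Digraph_Component.connected (with_proj G) \<longleftrightarrow> connected_on (pverts G) (parcs G)"
proof -
  let ?V = "pverts G" and ?E = "parcs G"
  have sub: "?E \<subseteq> ?V \<times> ?V" and s: "sym ?E"
    using assms by (auto simp: simple_graph_def)
  have "parcs (mk_symmetric (with_proj G)) = ?E"
    using s by (auto simp: mk_symmetric_def sym_def)
  moreover have "pverts (mk_symmetric (with_proj G)) = ?V"
    by (simp add: mk_symmetric_def)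
  moreover have "(u, v) \<in> rtrancl_on ?V ?E \<longleftrightarrow> (u, v) \<in> ?E\<^sup>*" if "u \<in> ?V" for u v
  proof
    assume "(u, v) \<in> rtrancl_on ?V ?E" then show "(u, v) \<in> ?E\<^sup>*"
      by (rule rtrancl_on_rtranclI)
  next
    assume "(u, v) \<in> ?E\<^sup>*"
    then show "(u, v) \<in> rtrancl_on ?V ?E"
    proof induction
      case base show ?case using that by simp
    next
      case (step y z)
      then show ?case using sub by (auto intro: rtrancl_on_into_rtrancl_on)
    qed
  qed
  ultimately show ?thesis
    by (auto simp: Digraph_Component.connected_def strongly_connected_def reachable_def
        connected_on_def)
qed

lemma realizes_iff:
  "realizes G ds \<longleftrightarrow> simple_graph (pverts G) (parcs G) \<and> card (pverts G) = length ds \<and>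
     image_mset (deg (parcs G)) (mset_set (pverts G)) = mset ds"
proof -
  have "out_degree (with_proj G) = deg (parcs G)"
    by (rule ext) (rule out_degree_with_proj)
  then show ?thesis
    by (simp add: realizes_def degree_mset_def pair_graph_iff_simple_graph)
qed

text \<open>
  The bridge to the digraph library: from here on, realizability and connectedness are statements
  about a plain symmetric relation, where relational operators such as images and closures apply.
\<close>

lemma graphical_iff:
  "(\<exists>G. realizes G ds) \<longleftrightarrow>
     (\<exists>(V :: nat set) E. simple_graph V E \<and> image_mset (deg E) (mset_set V) = mset ds)"
proof
  assume "\<exists>(V :: nat set) E. simple_graph V E \<and> image_mset (deg E) (mset_set V) = mset ds"
  then obtain V :: "nat set" and E where VE: "simple_graph V E" "image_mset (deg E) (mset_set V) = mset ds" by blast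
  then have "card V = length ds"
    by (metis size_image_mset size_mset size_mset_set)
  with VE have "realizes \<lparr>pverts = V, parcs = E\<rparr> ds" by (simp add: realizes_iff)
  then show "\<exists>G. realizes G ds" by blast
qed (auto simp: realizes_iff)

section \<open>Counting arcs\<close>

lemma card_arcs_eq_sum_deg:
  assumes "simple_graph V E" shows "card E = (\<Sum>v\<in>V. deg E v)"
proof -
  have "E = (SIGMA v:V. E `` {v})" using assms by (auto simp: simple_graph_def)
  moreover have "finite V" "\<And>v. finite (E `` {v})"
    using assms simple_graph_finite_arcs[OF assms] by (auto simp: simple_graph_def finite_Image)
  ultimately show ?thesis unfolding deg_def by (metis card_SigmaI)
qed

lemma card_arcs_eq_sum_list:
  assumes "simple_graph V E" "image_mset (deg E) (mset_set V) = mset ds"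
  shows "card E = sum_list ds"
proof -
  have "card E = sum_mset (image_mset (deg E) (mset_set V))"
    unfolding card_arcs_eq_sum_deg[OF assms(1)] by (rule sum_unfold_sum_mset)
  also have "\<dots> = sum_list ds" unfolding assms(2) by (rule sum_mset_sum_list)
  finally show ?thesis .
qed

text \<open>
  The arcs that increase along the order and their reversals are equally many.
\<close>

lemma even_card_arcs:
  fixes E :: "('a::linorder \<times> 'a) set"
  assumes "simple_graph V E" shows "even (card E)"
proof -
  let ?A = "{(a, b) \<in> E. a < b}"
  have fin: "finite E" and s: "sym E" and i: "irrefl E"
    using assms simple_graph_finite_arcs by (auto simp: simple_graph_def)
  have E: "E = ?A \<union> ?A\<inverse>"
    using s i by (auto simp: sym_def irrefl_def) (metis linorder_cases)
  have "card E = card ?A + card (?A\<inverse>)"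
    by (subst E, rule card_Un_disjoint) (use fin in \<open>auto intro: finite_subset\<close>)
  then show ?thesis by simp
qed

section \<open>Connected graphs and cycles\<close>

lemma rtrancl_leaves_set:
  assumes "(u, w) \<in> E\<^sup>*" "u \<in> S" "w \<notin> S"
  obtains x y where "(x, y) \<in> E" "x \<in> S" "y \<notin> S"
  using assms(1,3)
proof (induction arbitrary: thesis rule: rtrancl_induct)
  case base then show ?case using assms(2) by blast
next
  case (step y z)
  then show ?case by (cases "y \<in> S") blast+
qed

text \<open>
  Grow a vertex set from a single vertex: as long as it is not everything, connectedness provides
  an edge leaving it, and adding the far end of that edge adds at least two arcs.
\<close>

lemma connected_on_card_arcs:
  assumes g: "simple_graph V E" and c: "connected_on V E"
  shows "2 * (card V - 1) \<le> card E"
proof -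
  have fin: "finite V" "finite E" and sub: "E \<subseteq> V \<times> V" and s: "sym E"
    using g simple_graph_finite_arcs by (auto simp: simple_graph_def)
  have "\<exists>S\<subseteq>V. card S = Suc m \<and> 2 * m \<le> card (E \<inter> S \<times> S)" if "Suc m \<le> card V" for m
    using that
  proof (induction m)
    case 0
    from c obtain v where "v \<in> V" by (auto simp: connected_on_def)
    then show ?case by (intro exI[of _ "{v}"]) auto
  next
    case (Suc m)
    then obtain S where S: "S \<subseteq> V" "card S = Suc m" "2 * m \<le> card (E \<inter> S \<times> S)" by auto
    obtain u where u: "u \<in> S" using S(2) by fastforce
    obtain w where w: "w \<in> V" "w \<notin> S"
      using S Suc.prems by (metis Suc_n_not_le_n subsetI subset_antisym)
    have "(u, w) \<in> E\<^sup>*" using c u w S by (auto simp: connected_on_def)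
    then obtain x y where xy: "(x, y) \<in> E" "x \<in> S" "y \<notin> S"
      using u w by (auto elim: rtrancl_leaves_set)
    have yV: "y \<in> V" using xy sub by auto
    have finS: "finite S" using S fin finite_subset by blast
    let ?S = "insert y S"
    have "{(x, y), (y, x)} \<union> E \<inter> S \<times> S \<subseteq> E \<inter> ?S \<times> ?S"
      using xy s by (auto simp: sym_def)
    moreover have "card ({(x, y), (y, x)} \<union> E \<inter> S \<times> S) = 2 + card (E \<inter> S \<times> S)"
    proof -
      have "x \<noteq> y" using xy by auto
      then have "card {(x, y), (y, x)} = 2" by simp
      then show ?thesis using xy fin by (subst card_Un_disjoint) auto
    qed
    ultimately have "2 + card (E \<inter> S \<times> S) \<le> card (E \<inter> ?S \<times> ?S)"
      using card_mono fin by (metis finite_Int)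
    then show ?case using S yV xy finS by (intro exI[of _ ?S]) auto
  qed
  from this[of "card V - 1"] c fin
  obtain S where "2 * (card V - 1) \<le> card (E \<inter> S \<times> S)"
    by (auto simp: connected_on_def card_gt_0_iff Suc_leI)
  also have "\<dots> \<le> card E" using fin by (intro card_mono) auto
  finally show ?thesis .
qed

text \<open>
  An arc lies on a cycle exactly when its ends stay linked after the edge is deleted. This form
  avoids handling cycles as explicit walks.
\<close>

definition cycle_arc :: "('a \<times> 'a) set \<Rightarrow> 'a \<Rightarrow> 'a \<Rightarrow> bool" where
  "cycle_arc E u v \<longleftrightarrow> (u, v) \<in> E \<and> (u, v) \<in> (E - {(u, v), (v, u)})\<^sup>*"

lemma cycle_arc_mono: "cycle_arc F u v \<Longrightarrow> F \<subseteq> E \<Longrightarrow> cycle_arc E u v"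
  unfolding cycle_arc_def by (metis Diff_mono rtrancl_mono subset_iff order_refl)

text \<open>
  This is the bound on the number of edges of a forest, by induction on the number of vertices.
  If no edge lies on a cycle, deleting an edge \<open>uv\<close> splits the vertices into the set \<open>A\<close> reachable
  from \<open>u\<close> and a nonempty rest \<open>B\<close>. No remaining arc joins the two parts, so the bounds for \<open>A\<close> and
  \<open>B\<close> add up, and the gain of 2 from having two parts pays for the deleted edge.
\<close>

lemma cycle_arc_exists:
  assumes "simple_graph V E" "V \<noteq> {}" "2 * card V \<le> card E + 1"
  shows "\<exists>u v. cycle_arc E u v"
  using assms
proof (induction "card V" arbitrary: V E rule: less_induct)
  case less
  have fin: "finite V" "finite E" and sub: "E \<subseteq> V \<times> V" and s: "sym E" and i: "irrefl E"
    using less.prems(1) simple_graph_finite_arcs by (auto simp: simple_graph_def)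
  have "card V \<noteq> 0" using less.prems(2) fin by simp
  then have "E \<noteq> {}" using less.prems(3) by auto
  then obtain u v where uv: "(u, v) \<in> E" by auto
  let ?F = "E - {(u, v), (v, u)}"
  show ?case
  proof (rule ccontr)
    assume no: "\<not> ?thesis"
    define A where "A = {w \<in> V. (u, w) \<in> ?F\<^sup>*}"
    define B where "B = V - A"
    have V: "u \<in> V" "v \<in> V" "u \<noteq> v" using uv sub i by (auto simp: irrefl_def)
    have uA: "u \<in> A" using V by (auto simp: A_def)
    have vB: "v \<in> B" using no uv V by (auto simp: B_def A_def cycle_arc_def)
    have symF: "sym ?F" using s by (auto simp: sym_def)
    have closed: "y \<in> A \<longleftrightarrow> x \<in> A" if "(x, y) \<in> ?F" for x y
    proof -
      have "(y, x) \<in> ?F" using symF that by (auto simp: sym_def)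
      then show ?thesis
        using that sub by (auto simp: A_def intro: rtrancl_into_rtrancl)
    qed
    have split: "?F = (?F \<inter> A \<times> A) \<union> (?F \<inter> B \<times> B)"
      using closed sub by (auto simp: B_def)
    have AB: "A \<union> B = V" "A \<inter> B = {}" by (auto simp: A_def B_def)
    \<comment> \<open>The bound for a part is the contrapositive of the induction hypothesis.\<close>
    have bound: "card (?F \<inter> C \<times> C) + 2 \<le> 2 * card C" if C: "C \<subseteq> V" "C \<noteq> {}" "C \<noteq> V" for C
    proof (rule ccontr)
      assume "\<not> ?thesis"
      moreover have "card C < card V" using C fin by (simp add: psubset_card_mono psubsetI)
      moreover have "simple_graph C (?F \<inter> C \<times> C)"
        using C fin finite_subset symF i by (auto simp: simple_graph_def sym_def irrefl_def)
      ultimately have "\<exists>u v. cycle_arc (?F \<inter> C \<times> C) u v"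
        using less.hyps C by simp
      with no show False by (meson Diff_subset Int_lower1 cycle_arc_mono order_trans)
    qed
    have two: "{(u, v), (v, u)} \<subseteq> E" "card {(u, v), (v, u)} = 2"
      using uv s V by (auto simp: sym_def)
    then have "card E = card ?F + 2"
      using card_Diff_subset[OF _ two(1)] card_mono[OF fin(2) two(1)] by simp
    moreover have "card ?F = card (?F \<inter> A \<times> A) + card (?F \<inter> B \<times> B)"
      by (subst split, rule card_Un_disjoint) (use fin AB in auto)
    moreover have "card (?F \<inter> A \<times> A) + 2 \<le> 2 * card A" "card (?F \<inter> B \<times> B) + 2 \<le> 2 * card B"
      by (rule bound; use uA vB AB in blast)+
    ultimately have "card E + 2 \<le> 2 * card A + 2 * card B" by linarith
    also have "\<dots> = 2 * card V"
      using AB fin by (metis card_Un_disjoint distrib_left finite_Un)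
    finally show False using less.prems by simp
  qed
qed

section \<open>Edge switches and connected realizations\<close>

text \<open>
  Replace the edges \<open>uv\<close> and \<open>xy\<close> by \<open>ux\<close> and \<open>vy\<close>. Every vertex trades one neighbour for another,
  so degrees do not change; if no edge joins \<open>{u, v}\<close> to \<open>{x, y}\<close>, the result is again simple.
\<close>

definition switch :: "'a \<Rightarrow> 'a \<Rightarrow> 'a \<Rightarrow> 'a \<Rightarrow> ('a \<times> 'a) set \<Rightarrow> ('a \<times> 'a) set" where
  "switch u v x y E =
     (E - {(u, v), (v, u), (x, y), (y, x)}) \<union> {(u, x), (x, u), (v, y), (y, v)}"

lemma
  assumes g: "simple_graph V E" and arcs: "(u, v) \<in> E" "(x, y) \<in> E"
    and closed: "\<And>a b. (a, b) \<in> E \<Longrightarrow> a \<in> C \<longleftrightarrow> b \<in> C" and C: "u \<in> C" "x \<notin> C"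
  shows simple_graph_switch: "simple_graph V (switch u v x y E)"
    and deg_switch: "deg (switch u v x y E) w = deg E w"
proof -
  have fin: "finite V" "finite E" and sub: "E \<subseteq> V \<times> V" and s: "sym E" and i: "irrefl E"
    using g simple_graph_finite_arcs by (auto simp: simple_graph_def)
  have vy: "v \<in> C" "y \<notin> C" using closed arcs C by blast+
  have ne: "u \<noteq> v" "x \<noteq> y" using arcs i by (auto simp: irrefl_def)
  have rev: "(v, u) \<in> E" "(y, x) \<in> E" using arcs s by (auto simp: sym_def)
  have dist: "u \<noteq> x" "u \<noteq> y" "v \<noteq> x" "v \<noteq> y" using C vy by auto
  have "sym (switch u v x y E)" using s by (auto simp: switch_def sym_def)
  moreover have "irrefl (switch u v x y E)" using i dist by (auto simp: switch_def irrefl_def)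
  moreover have "switch u v x y E \<subseteq> V \<times> V" using sub arcs by (auto simp: switch_def)
  ultimately show "simple_graph V (switch u v x y E)" using fin by (simp add: simple_graph_def)
  have card: "card (insert b (E `` {w} - {a})) = card (E `` {w})"
    if "a \<in> E `` {w}" "b \<notin> E `` {w}" for a b
  proof -
    have "finite (E `` {w})" using fin by (simp add: finite_Image)
    moreover from this that(1) have "Suc (card (E `` {w} - {a})) = card (E `` {w})"
      by (rule card_Suc_Diff1)
    ultimately show ?thesis using that(2) by simp
  qed
  have out: "(u, x) \<notin> E" "(x, u) \<notin> E" "(v, y) \<notin> E" "(y, v) \<notin> E"
    using closed C vy by blast+
  consider "w = u" | "w = v" | "w = x" | "w = y" | "w \<notin> {u, v, x, y}" by blast
  then show "deg (switch u v x y E) w = deg E w"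
  proof cases
    case 1
    then have "switch u v x y E `` {w} = insert x (E `` {w} - {v})"
      using ne dist by (auto simp: switch_def)
    then show ?thesis using card[of v x] 1 arcs out by (simp only: deg_def Image_singleton_iff simp_thms not_False_eq_True)
  next
    case 2
    then have "switch u v x y E `` {w} = insert y (E `` {w} - {u})"
      using ne dist by (auto simp: switch_def)
    then show ?thesis using card[of u y] 2 rev out by (simp only: deg_def Image_singleton_iff simp_thms not_False_eq_True)
  next
    case 3
    then have "switch u v x y E `` {w} = insert u (E `` {w} - {y})"
      using ne dist by (auto simp: switch_def)
    then show ?thesis using card[of y u] 3 arcs out by (simp only: deg_def Image_singleton_iff simp_thms not_False_eq_True)
  next
    case 4
    then have "switch u v x y E `` {w} = insert v (E `` {w} - {x})"
      using ne dist by (auto simp: switch_def)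
    then show ?thesis using card[of x v] 4 rev out by (simp only: deg_def Image_singleton_iff simp_thms not_False_eq_True)
  next
    case 5
    then have "switch u v x y E `` {w} = E `` {w}" by (auto simp: switch_def)
    then show ?thesis by (simp add: deg_def)
  qed
qed

text \<open>
  The set \<open>C\<close> is the component of \<open>c\<close>. After the switch all of \<open>C\<close> must still be reachable, which
  could only fail because \<open>uv\<close> is gone. Either \<open>uv\<close> was on a cycle inside \<open>C\<close>, and the rest of the cycle
  replaces it; or \<open>xy\<close> was on a cycle outside \<open>C\<close>, and the detour over \<open>ux\<close>, the rest of that cycle,
  and \<open>yv\<close> replaces it. In both cases \<open>x\<close> joins the component.
\<close>

lemma switch_connects:
  assumes s: "sym E" and u: "u \<in> C"
    and closed: "\<And>a b. (a, b) \<in> E \<Longrightarrow> a \<in> C \<longleftrightarrow> b \<in> C"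
    and reach: "\<And>w. w \<in> C \<Longrightarrow> (c, w) \<in> E\<^sup>*" and c: "c \<in> C" and xy: "x \<notin> C" "y \<notin> C"
    and cyc: "cycle_arc (E \<inter> C \<times> C) u v \<or> cycle_arc (E \<inter> (- C) \<times> (- C)) x y"
  shows "insert x C \<subseteq> (switch u v x y E)\<^sup>* `` {c}"
proof -
  let ?E = "switch u v x y E"
  have symE: "sym ?E" using s by (auto simp: switch_def sym_def)
  then have symR: "sym (?E\<^sup>*)" by (rule sym_rtrancl)
  have "(u, v) \<in> ?E\<^sup>*" using cyc
  proof
    assume "cycle_arc (E \<inter> C \<times> C) u v"
    then have "(u, v) \<in> (E \<inter> C \<times> C - {(u, v), (v, u)})\<^sup>*" by (simp add: cycle_arc_def)
    moreover have "E \<inter> C \<times> C - {(u, v), (v, u)} \<subseteq> ?E" using xy by (auto simp: switch_def)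
    ultimately show ?thesis using rtrancl_mono by blast
  next
    assume "cycle_arc (E \<inter> (- C) \<times> (- C)) x y"
    then have v: "(x, y) \<in> (E \<inter> (- C) \<times> (- C) - {(x, y), (y, x)})\<^sup>*" by (simp add: cycle_arc_def)
    moreover have "E \<inter> (- C) \<times> (- C) - {(x, y), (y, x)} \<subseteq> ?E"
      using u by (auto simp: switch_def dest: closed)
    ultimately have "(x, y) \<in> ?E\<^sup>*" using rtrancl_mono by blast
    moreover have "(u, x) \<in> ?E" "(y, v) \<in> ?E" by (auto simp: switch_def)
    ultimately show ?thesis by (meson converse_rtrancl_into_rtrancl rtrancl_into_rtrancl)
  qed
  then have uv: "(u, v) \<in> ?E\<^sup>*" "(v, u) \<in> ?E\<^sup>*" using symR by (auto simp: sym_def)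
  have "(c, w) \<in> ?E\<^sup>* \<and> w \<in> C" if "(c, w) \<in> E\<^sup>*" for w
    using that
  proof induction
    case (step a b)
    then have "a \<in> C" "b \<in> C" using closed by blast+
    then have "(a, b) = (u, v) \<or> (a, b) = (v, u) \<or> (a, b) \<in> ?E"
      using step.hyps xy by (auto simp: switch_def)
    then have "(a, b) \<in> ?E\<^sup>*" using uv by auto
    with step.IH \<open>b \<in> C\<close> show ?case by (meson rtrancl_trans)
  qed (use c in auto)
  then have C: "C \<subseteq> ?E\<^sup>* `` {c}" using reach by blast
  moreover have "(u, x) \<in> ?E" by (auto simp: switch_def)
  ultimately show ?thesis using u by (auto intro: rtrancl_into_rtrancl)
qed

text \<open>
  If the component \<open>C\<close> of a vertex \<open>c\<close> is not everything, then either \<open>C\<close> or the set \<open>W\<close> of other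
  vertices has too many arcs for a forest, since two forests have at most \<open>2 * (card V - 2)\<close> arcs
  together. So there is an edge on a cycle in one of the two parts; positive degrees provide an edge in
  the other part, and switching the two enlarges the component of \<open>c\<close>.
\<close>

lemma connected_realization:
  assumes "simple_graph V E" "V \<noteq> {}" "\<And>v. v \<in> V \<Longrightarrow> 1 \<le> deg E v" "2 * (card V - 1) \<le> card E"
  shows "\<exists>F. simple_graph V F \<and> deg F = deg E \<and> connected_on V F"
proof -
  from assms(2) obtain c where c: "c \<in> V" by auto
  show ?thesis using assms(1,3,4)
  proof (induction "card V - card (E\<^sup>* `` {c})" arbitrary: E rule: less_induct)
    case less
    define C where "C = E\<^sup>* `` {c}"
    have fin: "finite V" "finite E" and sub: "E \<subseteq> V \<times> V" and s: "sym E"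
      using less.prems(1) simple_graph_finite_arcs by (auto simp: simple_graph_def)
    have symR: "sym (E\<^sup>*)" using s by (rule sym_rtrancl)
    have closure_in_V: "F\<^sup>* `` {c} \<subseteq> V" if "F \<subseteq> V \<times> V" for F
      using that c by (auto elim: rtranclE)
    have CV: "C \<subseteq> V" and cC: "c \<in> C" using closure_in_V[OF sub] by (auto simp: C_def)
    have finC: "finite C" using CV fin finite_subset by blast
    have closed: "a \<in> C \<longleftrightarrow> b \<in> C" if "(a, b) \<in> E" for a b
      using that s by (auto simp: C_def sym_def intro: rtrancl_into_rtrancl)
    show ?case
    proof (cases "C = V")
      case True
      then have "(a, b) \<in> E\<^sup>*" if "a \<in> V" "b \<in> V" for a b
        using that symR by (auto simp: C_def sym_def intro: rtrancl_trans)
      then show ?thesis using less.prems(1) c by (auto simp: connected_on_def)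
    next
      case False
      define W where "W = V - C"
      have W: "W \<noteq> {}" "finite W" "W \<subseteq> V" using False CV fin by (auto simp: W_def)
      have arc_at: "\<exists>b. (a, b) \<in> E" if "a \<in> V" for a
        using less.prems(2)[OF that] by (auto simp: deg_def Suc_le_eq card_gt_0_iff)
      have split: "E = E \<inter> C \<times> C \<union> E \<inter> W \<times> W" using closed sub by (auto simp: W_def)
      have "card E = card (E \<inter> C \<times> C) + card (E \<inter> W \<times> W)"
        by (subst split, rule card_Un_disjoint) (use fin in \<open>auto simp: W_def\<close>)
      moreover have "card V = card C + card W"
        using finC CV W fin by (simp add: W_def card_Diff_subset card_mono)
      moreover have "card C \<noteq> 0" "card W \<noteq> 0" using finC cC W by auto
      ultimately have "2 * card C \<le> card (E \<inter> C \<times> C) + 1 \<or> 2 * card W \<le> card (E \<inter> W \<times> W) + 1"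
        using less.prems(3) by linarith
      moreover have g: "simple_graph S (E \<inter> S \<times> S)" if "S \<subseteq> V" for S
        using less.prems(1) that finite_subset by (auto simp: simple_graph_def sym_def irrefl_def)
      ultimately have "(\<exists>u v. cycle_arc (E \<inter> C \<times> C) u v) \<or> (\<exists>x y. cycle_arc (E \<inter> W \<times> W) x y)"
        using cycle_arc_exists[OF g[OF CV]] cycle_arc_exists[OF g[OF W(3)]] cC W(1) by blast
      then obtain u v x y where uvxy: "(u, v) \<in> E" "u \<in> C" "(x, y) \<in> E" "x \<in> W"
        and cyc: "cycle_arc (E \<inter> C \<times> C) u v \<or> cycle_arc (E \<inter> W \<times> W) x y"
      proof
        assume "\<exists>u v. cycle_arc (E \<inter> C \<times> C) u v"
        then obtain u v where uv: "cycle_arc (E \<inter> C \<times> C) u v" by blast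
        obtain x where "x \<in> W" using W(1) by blast
        moreover then obtain y where "(x, y) \<in> E" using arc_at W(3) by blast
        ultimately show ?thesis using that[of u v x y] uv by (auto simp: cycle_arc_def)
      next
        assume "\<exists>x y. cycle_arc (E \<inter> W \<times> W) x y"
        then obtain x y where xy: "cycle_arc (E \<inter> W \<times> W) x y" by blast
        obtain v where "(c, v) \<in> E" using arc_at c by blast
        with xy cC show ?thesis using that[of c v x y] by (auto simp: cycle_arc_def)
      qed
      have sub_compl: "E \<inter> W \<times> W \<subseteq> E \<inter> (- C) \<times> (- C)" by (auto simp: W_def)
      from cyc have cyc': "cycle_arc (E \<inter> C \<times> C) u v \<or> cycle_arc (E \<inter> (- C) \<times> (- C)) x y"
        using cycle_arc_mono[OF _ sub_compl] by (elim disjE) simp_all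
      have xC: "x \<notin> C" using uvxy(4) by (simp add: W_def)
      then have yC: "y \<notin> C" using closed[OF uvxy(3)] by simp
      let ?F = "switch u v x y E"
      note sw = less.prems(1) uvxy(1,3) closed uvxy(2) xC
      have gF: "simple_graph V ?F" by (rule simple_graph_switch[OF sw])
      have dF: "deg ?F = deg E" by (rule ext, rule deg_switch[OF sw])
      have "insert x C \<subseteq> ?F\<^sup>* `` {c}"
        by (rule switch_connects[OF s uvxy(2) closed _ cC xC yC cyc']) (auto simp: C_def)
      moreover have "?F\<^sup>* `` {c} \<subseteq> V" using gF by (intro closure_in_V) (auto simp: simple_graph_def)
      ultimately have "card (insert x C) \<le> card (?F\<^sup>* `` {c})" "card (?F\<^sup>* `` {c}) \<le> card V"
        using fin by (auto intro!: card_mono intro: finite_subset)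
      then have "card V - card (?F\<^sup>* `` {c}) < card V - card (E\<^sup>* `` {c})"
        using xC finC by (simp add: C_def[symmetric])
      moreover have "card ?F = card E"
        using card_arcs_eq_sum_deg[OF gF] card_arcs_eq_sum_deg[OF less.prems(1)] dF by simp
      ultimately show ?thesis
        using less.hyps[of ?F] gF dF less.prems by metis
    qed
  qed
qed

section \<open>Realizing degree sequences with few edges\<close>

definition graphical :: "nat multiset \<Rightarrow> bool" where
  "graphical M \<longleftrightarrow> (\<exists>(V :: nat set) E. simple_graph V E \<and> image_mset (deg E) (mset_set V) = M)"

lemma graphical_add_isolated:
  assumes "graphical M" shows "graphical (add_mset 0 M)"
proof -
  from assms obtain V :: "nat set" and E where
    VE: "simple_graph V E" "image_mset (deg E) (mset_set V) = M" by (auto simp: graphical_def)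
  obtain w where w: "w \<notin> V"
    using VE(1) ex_new_if_finite[OF infinite_UNIV_nat] by (auto simp: simple_graph_def)
  have "simple_graph (insert w V) E" using VE(1) by (auto simp: simple_graph_def)
  moreover have "E `` {w} = {}" using VE(1) w by (auto simp: simple_graph_def)
  then have "image_mset (deg E) (mset_set (insert w V)) = add_mset 0 M"
    using VE w by (simp add: simple_graph_def deg_def)
  ultimately show ?thesis unfolding graphical_def by blast
qed

lemma graphical_add_leaf:
  assumes "graphical (add_mset d M)" shows "graphical (add_mset 1 (add_mset (Suc d) M))"
proof -
  from assms obtain V :: "nat set" and E where
    VE: "simple_graph V E" "image_mset (deg E) (mset_set V) = add_mset d M"
    by (auto simp: graphical_def)
  have fin: "finite V" "finite E" and sub: "E \<subseteq> V \<times> V"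
    using VE(1) simple_graph_finite_arcs by (auto simp: simple_graph_def)
  obtain w where w: "w \<notin> V" using fin ex_new_if_finite[OF infinite_UNIV_nat] by auto
  have "d \<in># image_mset (deg E) (mset_set V)" using VE(2) by simp
  then obtain u where u: "u \<in> V" "deg E u = d" using fin by auto
  define U where "U = V - {u}"
  have V: "V = insert u U" "u \<notin> U" "finite U" "w \<notin> U" "w \<noteq> u"
    using u w fin by (auto simp: U_def)
  have M: "image_mset (deg E) (mset_set U) = M" using VE(2) u V by simp
  let ?E = "E \<union> {(u, w), (w, u)}"
  have "simple_graph (insert w V) ?E"
    using VE(1) u w by (auto simp: simple_graph_def sym_def irrefl_def)
  moreover have "image_mset (deg ?E) (mset_set (insert w V)) = add_mset 1 (add_mset (Suc d) M)"
  proof -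
    have "?E `` {w} = {u}" using w sub V by auto
    then have "deg ?E w = 1" by (simp add: deg_def)
    moreover have "?E `` {u} = insert w (E `` {u})" "w \<notin> E `` {u}" using w sub V by auto
    then have "deg ?E u = Suc d" using u fin by (simp add: deg_def finite_Image)
    moreover have "?E `` {x} = E `` {x}" if "x \<in> U" for x using that V by auto
    then have "image_mset (deg ?E) (mset_set U) = image_mset (deg E) (mset_set U)"
      using V by (intro image_mset_cong) (simp add: deg_def)
    ultimately show ?thesis using V M by simp
  qed
  ultimately show ?thesis unfolding graphical_def by blast
qed

lemma size_le_sum_mset:
  fixes M :: "nat multiset"
  assumes "\<And>d. d \<in># M \<Longrightarrow> k \<le> d" shows "k * size M \<le> sum_mset M"
  using assms
proof (induction M)
  case (add x M)
  then have "k \<le> x" "k * size M \<le> sum_mset M" by simp_all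
  then show ?case by simp
qed simp

text \<open>
  Such a sequence is realized by a forest. If some \<open>d\<close> is at least 2, the bound on the sum
  forces a 1 to be present, because the average is below 2; removing that 1 and lowering \<open>d\<close> gives a
  smaller instance, and a new leaf undoes the step. If all entries are 1, they form a perfect
  matching, built by adding an isolated vertex and then a leaf at it. The induction ends at the
  empty multiset, for which only the first alternative of the last assumption holds.
\<close>

lemma graphical_of_small_sum:
  assumes "\<And>d. d \<in># M \<Longrightarrow> 1 \<le> d" "even (sum_mset M)"
    and "sum_mset M = size M \<or> sum_mset M + 2 \<le> 2 * size M"
  shows "graphical M"
  using assms
proof (induction "size M" arbitrary: M rule: less_induct)
  case less
  show ?case
  proof (cases "\<exists>d\<in>#M. 2 \<le> d")
    case True
    then obtain d where d: "d \<in># M" "2 \<le> d" by blast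
    then obtain M1 where M1: "M = add_mset d M1" by (metis mset_add)
    have "size M1 \<le> sum_mset M1" using size_le_sum_mset[of M1 1] less.prems(1) M1 by simp
    then have sum: "sum_mset M + 2 \<le> 2 * size M" using less.prems(3) M1 d by auto
    have "1 \<in># M"
    proof (rule ccontr)
      assume "\<not> ?thesis"
      then have "2 \<le> e" if "e \<in># M" for e using less.prems(1)[OF that] that
        by (metis One_nat_def Suc_1 Suc_leI le_neq_implies_less)
      then show False using size_le_sum_mset[of M 2] sum by simp
    qed
    then have "1 \<in># M1" using M1 d by auto
    then obtain M2 where M2: "M1 = add_mset 1 M2" by (metis mset_add)
    obtain e where e: "d = Suc e" "1 \<le> e" using d(2) by (cases d) auto
    have M: "M = add_mset 1 (add_mset (Suc e) M2)" using M1 M2 e by simp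
    have "graphical (add_mset e M2)"
    proof (rule less.hyps)
      show "size (add_mset e M2) < size M" using M by simp
      show "1 \<le> x" if "x \<in># add_mset e M2" for x
        using that less.prems(1)[of x] e(2) M by auto
      show "even (sum_mset (add_mset e M2))" using less.prems(2) M by simp
      show "sum_mset (add_mset e M2) = size (add_mset e M2) \<or>
          sum_mset (add_mset e M2) + 2 \<le> 2 * size (add_mset e M2)"
        using sum M by simp
    qed
    then show ?thesis unfolding M by (rule graphical_add_leaf)
  next
    case False
    then have ones: "\<And>d. d \<in># M \<Longrightarrow> d = 1" using less.prems(1) by fastforce
    show ?thesis
    proof (cases "M = {#}")
      case True
      then show ?thesis
        unfolding graphical_def by (intro exI[of _ "{}"]) (auto simp: simple_graph_def sym_def irrefl_def)
    next
      case False
      then obtain M1 where M1: "M = add_mset 1 M1" using ones by (metis multiset_nonemptyE mset_add)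
      then have "M1 \<noteq> {#}" using less.prems(2) by auto
      then obtain M2 where M2: "M1 = add_mset 1 M2"
        using ones M1 by (metis multiset_nonemptyE mset_add insert_iff set_mset_add_mset_insert)
      have "image_mset (\<lambda>x. x) M2 = image_mset (\<lambda>x. 1) M2"
        using ones M1 M2 by (intro image_mset_cong) auto
      then have "M2 = replicate_mset (size M2) 1" by (simp add: image_mset_const_eq)
      then have "sum_mset M2 = size M2"
        by (metis mult.right_neutral sum_mset_replicate_mset of_nat_id)
      moreover have "even (sum_mset M2)" "\<And>d. d \<in># M2 \<Longrightarrow> 1 \<le> d"
        using less.prems(1,2) M1 M2 by simp_all
      ultimately have "graphical M2" using M1 M2 by (intro less.hyps) simp_all
      then show ?thesis
        using graphical_add_leaf[OF graphical_add_isolated] M1 M2 by simp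
    qed
  qed
qed


section \<open>Which degree sequences have no connected realization\<close>

text \<open>
  An even number is below \<open>2 * (n - 1)\<close> exactly when it is at most \<open>2 * n - 4\<close>; the sum below avoids
  truncated subtraction.
\<close>

definition sparse_seqs :: "nat \<Rightarrow> nat list set" where
  "sparse_seqs n = {ds. length ds = n \<and> sorted_wrt (\<ge>) ds \<and> (\<forall>d\<in>set ds. 1 \<le> d) \<and>
     even (sum_list ds) \<and> sum_list ds + 4 \<le> 2 * n}"

lemma realization_verts:
  assumes "image_mset f (mset_set V) = mset ds"
  shows "card V = length ds" and "finite V \<Longrightarrow> set ds = f ` V"
proof -
  show "card V = length ds" using arg_cong[OF assms, of size] by simp
  show "set ds = f ` V" if "finite V" using arg_cong[OF assms, of set_mset] that by simp
qed

lemma sparse_seqs_subset_D: "sparse_seqs n \<subseteq> D n"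
proof
  fix ds assume ds: "ds \<in> sparse_seqs n"
  have "graphical (mset ds)"
    using ds by (intro graphical_of_small_sum) (auto simp: sparse_seqs_def sum_mset_sum_list)
  then show "ds \<in> D n"
    using ds by (auto simp: D_def graphical_iff graphical_def sparse_seqs_def)
qed

text \<open>
  A connected graph has at least \<open>n - 1\<close> edges, so sparse sequences are excluded; all others have
  enough edges for the switching argument.
\<close>

lemma Dc_eq:
  assumes "1 \<le> n" shows "Dc n = D n - sparse_seqs n"
proof (intro equalityI subsetI)
  fix ds assume ds: "ds \<in> Dc n"
  then obtain G where G: "realizes G ds" "Digraph_Component.connected (with_proj G)"
    by (auto simp: Dc_def)
  then have g: "simple_graph (pverts G) (parcs G)" by (simp add: realizes_iff)
  then have "2 * (card (pverts G) - 1) \<le> card (parcs G)"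
    using G connected_iff_connected_on connected_on_card_arcs by blast
  also have "card (parcs G) = sum_list ds"
    using G(1) g card_arcs_eq_sum_list by (auto simp: realizes_iff)
  finally have "2 * (n - 1) \<le> sum_list ds"
    using G(1) ds by (auto simp: realizes_iff Dc_def D_def)
  then show "ds \<in> D n - sparse_seqs n"
    using ds assms by (auto simp: Dc_def sparse_seqs_def)
next
  fix ds assume ds: "ds \<in> D n - sparse_seqs n"
  then obtain V :: "nat set" and E where
    VE: "simple_graph V E" "image_mset (deg E) (mset_set V) = mset ds"
    by (auto simp: D_def graphical_iff)
  have cardV: "card V = n"
    using realization_verts(1)[OF VE(2)] ds by (simp add: D_def)
  then have ne: "V \<noteq> {}" using assms by auto
  have fin: "finite V" using VE(1) by (simp add: simple_graph_def)
  have sum: "card E = sum_list ds" by (rule card_arcs_eq_sum_list[OF VE])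
  then have even: "even (sum_list ds)" using even_card_arcs[OF VE(1)] by simp
  with ds have "\<not> sum_list ds + 4 \<le> 2 * n" by (auto simp: D_def sparse_seqs_def)
  with even have "2 * (n - 1) \<le> sum_list ds" by presburger
  moreover have "1 \<le> deg E v" if "v \<in> V" for v
  proof -
    have "deg E v \<in># mset ds" using that fin unfolding VE(2)[symmetric] by simp
    then show ?thesis using ds by (auto simp: D_def)
  qed
  ultimately obtain F where F: "simple_graph V F" "deg F = deg E" "connected_on V F"
    using connected_realization[OF VE(1) ne] sum cardV by metis
  let ?G = "\<lparr>pverts = V, parcs = F\<rparr>"
  have "realizes ?G ds" "Digraph_Component.connected (with_proj ?G)"
    using F VE(2) cardV ds by (auto simp: realizes_iff connected_iff_connected_on D_def)
  then show "ds \<in> Dc n" using ds by (auto simp: Dc_def)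
qed

lemma finite_D: "finite (D n)"
proof (rule finite_subset)
  show "D n \<subseteq> {ds. set ds \<subseteq> {..n} \<and> length ds = n}"
  proof
    fix ds assume ds: "ds \<in> D n"
    then obtain V :: "nat set" and E where
      VE: "simple_graph V E" "image_mset (deg E) (mset_set V) = mset ds"
      by (auto simp: D_def graphical_iff)
    have fin: "finite V" and sub: "E \<subseteq> V \<times> V" using VE(1) by (auto simp: simple_graph_def)
    have "card V = n"
      using realization_verts(1)[OF VE(2)] ds by (simp add: D_def)
    moreover have "deg E v \<le> card V" for v
      unfolding deg_def using fin sub by (intro card_mono) auto
    moreover have "set ds = deg E ` V"
      using realization_verts(2)[OF VE(2) fin] .
    ultimately show "ds \<in> {ds. set ds \<subseteq> {..n} \<and> length ds = n}" using ds by (auto simp: D_def)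
  qed
qed (rule finite_lists_length_eq, simp)

corollary card_Dc:
  assumes "1 \<le> n" shows "int (card (Dc n)) = int (card (D n)) - int (card (sparse_seqs n))"
proof -
  have "finite (sparse_seqs n)" "card (sparse_seqs n) \<le> card (D n)"
    using finite_D sparse_seqs_subset_D by (auto intro: finite_subset card_mono)
  then show ?thesis
    using sparse_seqs_subset_D by (simp add: Dc_eq[OF assms] card_Diff_subset of_nat_diff)
qed

section \<open>Counting partitions\<close>

definition bounded_partitions :: "nat \<Rightarrow> nat \<Rightarrow> nat list set" where
  "bounded_partitions m k = {p. is_partition (int m) p \<and> (\<forall>x\<in>set p. x \<le> k)}"

definition num_partitions :: "nat \<Rightarrow> nat \<Rightarrow> nat" where
  "num_partitions m k = card (bounded_partitions m k)"

lemma length_le_sum_list: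
  fixes p :: "nat list"
  assumes "\<forall>x\<in>set p. 1 \<le> x" shows "length p \<le> sum_list p"
  using assms by (induction p) auto

lemma length_partition_le: "is_partition (int m) p \<Longrightarrow> length p \<le> m"
  using length_le_sum_list[of p] by (auto simp: is_partition_def)

lemma part_le: "is_partition (int m) p \<Longrightarrow> x \<in> set p \<Longrightarrow> x \<le> m"
  using member_le_sum_list[of x p] by (auto simp: is_partition_def)

lemma finite_bounded_partitions: "finite (bounded_partitions m k)"
proof (rule finite_subset)
  show "bounded_partitions m k \<subseteq> {p. set p \<subseteq> {..k} \<and> length p \<le> m}"
    by (auto simp: bounded_partitions_def length_partition_le)
qed (rule finite_lists_length_le, simp)

lemma bounded_partitions_saturate:
  assumes "m \<le> k" shows "bounded_partitions m k = bounded_partitions m m"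
  using assms part_le by (fastforce simp: bounded_partitions_def)

lemma num_partitions_0: "num_partitions m 0 = (if m = 0 then 1 else 0)"
proof -
  have "bounded_partitions m 0 = (if m = 0 then {[]} else {})"
  proof -
    have "p \<in> bounded_partitions m 0 \<longleftrightarrow> p = [] \<and> m = 0" for p
      by (cases p) (auto simp: bounded_partitions_def is_partition_def)
    then show ?thesis by auto
  qed
  then show ?thesis by (simp add: num_partitions_def)
qed

text \<open>
  Either no part equals \<open>Suc k\<close>, or the first part does and can be removed.
\<close>

lemma num_partitions_Suc:
  "num_partitions m (Suc k) =
     num_partitions m k + (if Suc k \<le> m then num_partitions (m - Suc k) (Suc k) else 0)"
proof -
  let ?new = "if Suc k \<le> m then (#) (Suc k) ` bounded_partitions (m - Suc k) (Suc k) else {}"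
  have "p \<in> bounded_partitions m (Suc k) \<longleftrightarrow> p \<in> bounded_partitions m k \<union> ?new" for p
  proof (cases p)
    case (Cons x q)
    have head: "p \<in> bounded_partitions m j \<longleftrightarrow> is_partition (int m) p \<and> x \<le> j" for j
      unfolding bounded_partitions_def Cons by (auto simp: is_partition_def intro: order_trans)
    show ?thesis
    proof (cases "x = Suc k")
      case True
      then show ?thesis unfolding head unfolding Cons
        by (auto simp: bounded_partitions_def is_partition_def of_nat_diff image_iff)
    next
      case False
      then have "p \<notin> ?new" using Cons by auto
      then show ?thesis using False by (auto simp: head)
    qed
  qed (auto simp: bounded_partitions_def)
  then have "bounded_partitions m (Suc k) = bounded_partitions m k \<union> ?new" by blast
  moreover have "bounded_partitions m k \<inter> ?new = {}" by (auto simp: bounded_partitions_def)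
  moreover have "card ?new = (if Suc k \<le> m then num_partitions (m - Suc k) (Suc k) else 0)"
    by (simp add: num_partitions_def card_image)
  ultimately show ?thesis
    by (simp only: num_partitions_def)
      (subst card_Un_disjoint, auto simp: finite_bounded_partitions)
qed

text \<open>
  The summand for \<open>j\<close> counts the partitions with largest part \<open>j\<close>; this unfolds the recurrence.
  The empty partition of 0 is the contribution of \<open>j = 0\<close>.
\<close>

lemma num_partitions_by_largest:
  "num_partitions m k = (\<Sum>j\<le>k. if j \<le> m then num_partitions (m - j) j else 0)"
  by (induction k) (simp_all only: sum.atMost_Suc num_partitions_Suc[of m], simp add: num_partitions_0)

lemma sorted_dec_split:
  fixes ds :: "nat list"
  assumes "sorted_wrt (\<ge>) ds" "\<forall>d\<in>set ds. 1 \<le> d"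
  shows "\<exists>q j. sorted_wrt (\<ge>) q \<and> (\<forall>x\<in>set q. 1 \<le> x) \<and> ds = map Suc q @ replicate j 1"
  using assms
proof (induction ds)
  case Nil
  show ?case by (intro exI[of _ "[]"] exI[of _ 0]) simp
next
  case (Cons d ds)
  then obtain q j where q: "sorted_wrt (\<ge>) q" "\<forall>x\<in>set q. 1 \<le> x" "ds = map Suc q @ replicate j 1"
    by auto
  show ?case
  proof (cases "d = 1")
    case True
    then have "q = []" using q Cons.prems by (cases q) auto
    then show ?thesis using True q by (intro exI[of _ "[]"] exI[of _ "Suc j"]) simp
  next
    case False
    then obtain e where e: "d = Suc e" "1 \<le> e" using Cons.prems(2) by (cases d) auto
    have "\<forall>x\<in>set q. x \<le> e" using q(3) e(1) Cons.prems(1) by auto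
    then show ?thesis using q e by (intro exI[of _ "e # q"] exI[of _ j]) simp
  qed
qed

text \<open>
  Partitions of \<open>m\<close> correspond to sequences of \<open>n\<close> positive integers with sum \<open>m + n\<close>, by adding 1
  to each part and to the missing parts, regarded as 0.
\<close>

definition pad :: "nat \<Rightarrow> nat list \<Rightarrow> nat list" where
  "pad n q = map Suc q @ replicate (n - length q) 1"

lemma inj_on_pad: "inj_on (pad n) (bounded_partitions m k)"
proof (rule inj_on_inverseI)
  fix q assume "q \<in> bounded_partitions m k"
  then have "\<forall>x\<in>set q. 1 \<le> x" by (simp add: bounded_partitions_def is_partition_def)
  then have "filter (\<lambda>d. 1 < d) (map Suc q) = map Suc q" by (auto simp: filter_id_conv)
  then show "map (\<lambda>d. d - 1) (filter (\<lambda>d. 1 < d) (pad n q)) = q"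
    by (simp add: pad_def comp_def)
qed

lemma sum_list_pad: "length q \<le> n \<Longrightarrow> sum_list (pad n q) = sum_list q + n"
  by (simp add: pad_def sum_list_Suc sum_list_replicate)

lemma sparse_seqs_eq:
  "sparse_seqs n = (\<Union>m\<in>{m. m + 4 \<le> n \<and> even (m + n)}. pad n ` bounded_partitions m m)"
proof (intro equalityI subsetI)
  fix ds assume ds: "ds \<in> sparse_seqs n"
  then obtain q j where q: "sorted_wrt (\<ge>) q" "\<forall>x\<in>set q. 1 \<le> x" "ds = map Suc q @ replicate j 1"
    using sorted_dec_split unfolding sparse_seqs_def by blast
  then have "ds = pad n q" "length q \<le> n" using ds by (auto simp: pad_def sparse_seqs_def)
  moreover have "q \<in> bounded_partitions (sum_list q) (sum_list q)"
    using q member_le_sum_list[of _ q] by (auto simp: bounded_partitions_def is_partition_def)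
  moreover have "sum_list q + 4 \<le> n \<and> even (sum_list q + n)"
    using ds sum_list_pad[of q n] calculation by (auto simp: sparse_seqs_def)
  ultimately show "ds \<in> (\<Union>m\<in>{m. m + 4 \<le> n \<and> even (m + n)}. pad n ` bounded_partitions m m)"
    by blast
next
  fix ds assume "ds \<in> (\<Union>m\<in>{m. m + 4 \<le> n \<and> even (m + n)}. pad n ` bounded_partitions m m)"
  then obtain m q where m: "m + 4 \<le> n" "even (m + n)" and ds: "ds = pad n q"
    and q: "is_partition (int m) q" by (auto simp: bounded_partitions_def)
  have "length q \<le> n" using length_partition_le[OF q] m by simp
  moreover have "sum_list q = m" using q by (simp add: is_partition_def)
  moreover have "sorted_wrt (\<ge>) (replicate j (1::nat))" for j by (induction j) auto
  then have "sorted_wrt (\<ge>) ds"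
    using q unfolding ds pad_def is_partition_def by (auto simp: sorted_wrt_append sorted_wrt_map)
  ultimately show "ds \<in> sparse_seqs n"
    using m q sum_list_pad[of q n] unfolding ds sparse_seqs_def
    by (auto simp: pad_def)
qed

lemma card_sparse_seqs:
  "card (sparse_seqs n) = (\<Sum>m | m + 4 \<le> n \<and> even (m + n). num_partitions m m)"
proof -
  have "card (sparse_seqs n) =
      (\<Sum>m | m + 4 \<le> n \<and> even (m + n). card (pad n ` bounded_partitions m m))"
    unfolding sparse_seqs_eq
  proof (rule card_UN_disjoint)
    show "finite {m. m + 4 \<le> n \<and> even (m + n)}" by (rule finite_subset[of _ "{..n}"]) auto
    have sum: "sum_list ds = m + n"
      if ds: "ds \<in> pad n ` bounded_partitions m m" and m: "m + 4 \<le> n" for ds m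
    proof -
      obtain q where q: "ds = pad n q" "is_partition (int m) q"
        using ds by (auto simp: bounded_partitions_def)
      then show ?thesis
        using length_partition_le[OF q(2)] sum_list_pad[of q n] m by (simp add: is_partition_def)
    qed
    show "\<forall>i\<in>{m. m + 4 \<le> n \<and> even (m + n)}. \<forall>j\<in>{m. m + 4 \<le> n \<and> even (m + n)}.
       i \<noteq> j \<longrightarrow> pad n ` bounded_partitions i i \<inter> pad n ` bounded_partitions j j = {}"
    proof (intro ballI impI)
      fix i j assume ij: "i \<in> {m. m + 4 \<le> n \<and> even (m + n)}" "j \<in> {m. m + 4 \<le> n \<and> even (m + n)}" "i \<noteq> j"
      show "pad n ` bounded_partitions i i \<inter> pad n ` bounded_partitions j j = {}"
        using sum[of _ i] sum[of _ j] ij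
        by (metis (lifting) add_right_cancel disjoint_iff mem_Collect_eq)
    qed
  qed (simp add: finite_bounded_partitions)
  then show ?thesis by (simp add: card_image[OF inj_on_pad] num_partitions_def)
qed

section \<open>The inequalities on Ferrers diagrams\<close>

lemma durfee_square: "{1..durfee p} \<times> {1..durfee p} \<subseteq> ferrers p"
proof -
  let ?M = "{m. {1..m} \<times> {1..m} \<subseteq> ferrers p}"
  have "m \<le> length p" if "m \<in> ?M" for m
  proof (cases "m = 0")
    case False
    then have "(m, m) \<in> ferrers p" using that by auto
    then show ?thesis by (simp add: ferrers_def)
  qed simp
  then have "finite ?M" by (intro finite_subset[of ?M "{..length p}"]) auto
  moreover have "0 \<in> ?M" by simp
  ultimately have "Max ?M \<in> ?M" by (intro Max_in) blast+
  then show ?thesis by (simp add: durfee_def)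
qed

lemma sum_rows_le:
  assumes "t \<le> length p" shows "(\<Sum>i=1..t. row p i) \<le> sum_list p"
proof -
  have "row p i = p ! (i - 1)" if "i \<in> {1..t}" for i
  proof -
    have "{j. (i, j) \<in> ferrers p} = {1..p ! (i - 1)}" using that assms by (auto simp: ferrers_def)
    then show ?thesis by (simp add: row_def)
  qed
  then have "(\<Sum>i=1..t. row p i) = (\<Sum>i=1..t. p ! (i - 1))" by simp
  also have "\<dots> = (\<Sum>i<t. p ! i)"
    by (rule sum.reindex_bij_witness[of _ Suc "\<lambda>i. i - 1"]) auto
  also have "\<dots> \<le> (\<Sum>i<length p. p ! i)" using assms by (intro sum_mono2) auto
  also have "\<dots> = sum_list p" by (simp add: sum_list_sum_nth atLeast0LessThan)
  finally show ?thesis .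
qed

lemma col_pos:
  assumes "i \<in> {1..durfee p}" shows "1 \<le> col p i"
proof -
  have "(1, i) \<in> ferrers p" using assms durfee_square by fastforce
  then have "1 \<in> {j. (j, i) \<in> ferrers p}" by simp
  moreover have "finite {j. (j, i) \<in> ferrers p}"
    by (rule finite_subset[of _ "{..length p}"]) (auto simp: ferrers_def)
  ultimately show ?thesis unfolding col_def by (metis Suc_leI One_nat_def card_gt_0_iff empty_iff)
qed

text \<open>
  For \<open>t\<close> up to the size of the Durfee square, the first \<open>t\<close> columns are nonempty and contribute at
  least \<open>t\<close>, while the first \<open>t\<close> rows contribute at most the whole partition \<open>m\<close>, which \<open>s\<close> covers.
\<close>

lemma P4_eq_P3:
  assumes "0 \<le> s" "m \<le> s" shows "P4 m k l s = P3 m k l"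
proof -
  have "int t \<le> s + (\<Sum>i=1..t. r p i)" if p: "p \<in> P3 m k l" and t: "t \<in> {1..durfee p}" for p t
  proof -
    have "(t, t) \<in> ferrers p" using durfee_square t by fastforce
    then have "(\<Sum>i=1..t. row p i) \<le> sum_list p" by (intro sum_rows_le) (simp add: ferrers_def)
    moreover have "int (sum_list p) = m" using p by (simp add: P3_def is_partition_def)
    ultimately have "(\<Sum>i=1..t. int (row p i)) \<le> m" by (metis of_nat_mono of_nat_sum)
    moreover have "(\<Sum>i=1..t. 1) \<le> (\<Sum>i=1..t. int (col p i))"
    proof (rule sum_mono)
      fix i assume "i \<in> {1..t}"
      then show "1 \<le> int (col p i)" using col_pos[of i p] t by simp
    qed
    ultimately show ?thesis using assms by (simp add: r_def sum_subtractf)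
  qed
  then show ?thesis using assms by (auto simp: P4_def)
qed

text \<open>
  Here \<open>j = k - 1\<close> and \<open>m = N - n\<close>; the assumption on \<open>m\<close> bounds the partitioned number \<open>m - j\<close>
  both by \<open>n - j - 2\<close>, which gives the Durfee inequalities, and by \<open>n - 1\<close>, which gives the bound on
  the number of parts.
\<close>

lemma card_P4:
  assumes "m + 4 \<le> n" "j + 2 \<le> n"
  shows "card (P4 (int m - int j) (int j) (int n - 1) (int n - int j - 2)) =
    (if j \<le> m then num_partitions (m - j) j else 0)"
proof -
  have "P4 (int m - int j) (int j) (int n - 1) (int n - int j - 2) =
      P3 (int m - int j) (int j) (int n - 1)"
    using assms by (intro P4_eq_P3) auto
  also have "\<dots> = (if j \<le> m then bounded_partitions (m - j) j else {})"
  proof (cases "j \<le> m")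
    case True
    then have eq: "int m - int j = int (m - j)" by simp
    show ?thesis
      using True assms length_partition_le[of "m - j"]
      unfolding eq by (fastforce simp: P3_def bounded_partitions_def)
  next
    case False
    then show ?thesis by (auto simp: P3_def is_partition_def)
  qed
  finally show ?thesis by (simp add: num_partitions_def)
qed

text \<open>
  The summand for \<open>k\<close> counts the degree sequences with largest degree \<open>k\<close>, with 1 subtracted from every
  entry and the first entry removed. Summing over \<open>k\<close> is the decomposition of all partitions of \<open>m\<close> by
  their largest part.
\<close>

lemma sum_card_P4:
  assumes "m + 4 \<le> n"
  shows "(\<Sum>k = 1..int n - 1. int (card (P4 (int m + int n - k - int n + 1) (k - 1) (int n - 1) (int n - k - 1)))) =
    int (num_partitions m m)"
proof -
  have "(\<Sum>k = 1..int n - 1. int (card (P4 (int m + int n - k - int n + 1) (k - 1) (int n - 1) (int n - k - 1)))) =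
      (\<Sum>j\<le>n - 2. int (card (P4 (int m - int j) (int j) (int n - 1) (int n - int j - 2))))"
    by (rule sum.reindex_bij_witness[of _ "\<lambda>j. int j + 1" "\<lambda>k. nat (k - 1)"])
      (use assms in \<open>auto simp: algebra_simps\<close>)
  also have "\<dots> = (\<Sum>j\<le>n - 2. int (if j \<le> m then num_partitions (m - j) j else 0))"
    using assms by (intro sum.cong refl arg_cong[of _ _ int] card_P4) auto
  also have "\<dots> = int (num_partitions m (n - 2))"
    unfolding num_partitions_by_largest[of m "n - 2"] by simp
  also have "num_partitions m (n - 2) = num_partitions m m"
    unfolding num_partitions_def by (subst bounded_partitions_saturate) (use assms in auto)
  finally show ?thesis .
qed

lemma sum_P4_eq_card_sparse_seqs:
  "(\<Sum>N | int n \<le> N \<and> N < 2 * (int n - 1) \<and> even N.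
     \<Sum>k = 1..int n - 1. int (card (P4 (N - k - int n + 1) (k - 1) (int n - 1) (int n - k - 1)))) =
   int (card (sparse_seqs n))"
proof -
  have "(\<Sum>N | int n \<le> N \<and> N < 2 * (int n - 1) \<and> even N.
     \<Sum>k = 1..int n - 1. int (card (P4 (N - k - int n + 1) (k - 1) (int n - 1) (int n - k - 1)))) =
    (\<Sum>m | m + 4 \<le> n \<and> even (m + n). int (num_partitions m m))"
  proof (rule sum.reindex_bij_witness[of _ "\<lambda>m. int m + int n" "\<lambda>N. nat (N - int n)"])
    fix N assume "N \<in> {N. int n \<le> N \<and> N < 2 * (int n - 1) \<and> even N}"
    then have N: "int n \<le> N" "N < 2 * (int n - 1)" "even N" by auto
    then obtain m where m: "N = int m + int n" by (metis add.commute zle_iff_zadd)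
    have "m + 4 \<le> n" "even (m + n)" using N unfolding m by presburger+
    then show "int (nat (N - int n)) + int n = N"
      "nat (N - int n) \<in> {m. m + 4 \<le> n \<and> even (m + n)}"
      "int (num_partitions (nat (N - int n)) (nat (N - int n))) =
        (\<Sum>k = 1..int n - 1. int (card (P4 (N - k - int n + 1) (k - 1) (int n - 1) (int n - k - 1))))"
      using sum_card_P4[of m n] by (simp_all add: m)
  qed auto
  then show ?thesis by (simp add: card_sparse_seqs)
qed


section \<open>Running time of programs\<close>

text \<open>
  An evaluator for loop-free code, with the time taken. It makes the effect of such code
  computable by rewriting.
\<close>

fun straight :: "com \<Rightarrow> mem \<Rightarrow> (nat \<times> mem) option" where
  "straight (Copy x a) m = (case opval m a of Some u \<Rightarrow> Some (1, m(Scalar x \<mapsto> u)) | None \<Rightarrow> None)"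
| "straight (Add x a b) m =
     (case (opval m a, opval m b) of (Some u, Some v) \<Rightarrow> Some (1, m(Scalar x \<mapsto> u + v)) | _ \<Rightarrow> None)"
| "straight (Sub x a b) m =
     (case (opval m a, opval m b) of (Some u, Some v) \<Rightarrow> Some (1, m(Scalar x \<mapsto> u - v)) | _ \<Rightarrow> None)"
| "straight (Load x A i) m =
     (case opval m i of
        Some u \<Rightarrow> if 0 \<le> u
          then (case m (Elem A (nat u)) of Some v \<Rightarrow> Some (1, m(Scalar x \<mapsto> v)) | None \<Rightarrow> None)
          else None
      | None \<Rightarrow> None)"
| "straight (Store A i a) m =
     (case (opval m i, opval m a) of
        (Some u, Some v) \<Rightarrow> if 0 \<le> u \<and> (\<forall>j<nat u. m (Elem A j) \<noteq> None)
          then Some (1, m(Elem A (nat u) \<mapsto> v)) else None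
      | _ \<Rightarrow> None)"
| "straight (Seq c1 c2) m =
     (case straight c1 m of
        Some (t1, m1) \<Rightarrow>
          (case straight c2 m1 of Some (t2, m2) \<Rightarrow> Some (t1 + t2, m2) | None \<Rightarrow> None)
      | None \<Rightarrow> None)"
| "straight _ m = None"

lemma exec_straight: "straight c m = Some (t, m') \<Longrightarrow> exec c m t m'"
proof (induction c arbitrary: m t m')
  case (Seq c1 c2)
  then obtain t1 m1 t2 where 1: "straight c1 m = Some (t1, m1)" "straight c2 m1 = Some (t2, m')"
    and t: "t = t1 + t2" by (auto split: option.splits)
  show ?case unfolding t using Seq.IH(1)[OF 1(1)] Seq.IH(2)[OF 1(2)] by (rule exec.Seq)
qed (auto simp del: One_nat_def fun_upd_apply split: option.splits if_splits intro: exec.intros)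

definition runs :: "com \<Rightarrow> mem \<Rightarrow> nat \<Rightarrow> (mem \<Rightarrow> bool) \<Rightarrow> bool" where
  "runs c m T Q \<longleftrightarrow> (\<exists>t m'. exec c m t m' \<and> t \<le> T \<and> Q m')"

lemma runs_straight:
  assumes "straight c m = Some (T, m')" "Q m'" shows "runs c m T Q"
  using assms exec_straight unfolding runs_def by blast

lemma runs_mono:
  assumes "runs c m T Q" "T \<le> T'" "\<And>m. Q m \<Longrightarrow> Q' m" shows "runs c m T' Q'"
  using assms unfolding runs_def by (meson order_trans)

lemma runs_Seq:
  assumes "runs c1 m T1 R" "\<And>m1. R m1 \<Longrightarrow> runs c2 m1 T2 Q"
  shows "runs (Seq c1 c2) m (T1 + T2) Q"
proof -
  obtain t1 m1 where 1: "exec c1 m t1 m1" "t1 \<le> T1" "R m1" using assms(1) by (auto simp: runs_def)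
  obtain t2 m2 where 2: "exec c2 m1 t2 m2" "t2 \<le> T2" "Q m2"
    using assms(2)[OF 1(3)] by (auto simp: runs_def)
  show ?thesis
    unfolding runs_def using exec.Seq[OF 1(1) 2(1)] 1(2) 2(2,3) add_mono by blast
qed

text \<open>
  The rule for a loop whose number of iterations \<open>N\<close> is known; \<open>I i\<close> holds after \<open>i\<close> iterations.
  Each iteration costs its body and one test, and the final test costs 1 more.
\<close>

lemma runs_While:
  assumes "I 0 m"
    and step: "\<And>i m. i < N \<Longrightarrow> I i m \<Longrightarrow> testval m b True \<and> runs c m T (I (Suc i))"
    and stop: "\<And>m. I N m \<Longrightarrow> testval m b False"
  shows "runs (While b c) m (N * (T + 1) + 1) (I N)"
proof -
  have "runs (While b c) m (k * (T + 1) + 1) (I N)" if "I (N - k) m" "k \<le> N" for k m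
    using that
  proof (induction k arbitrary: m)
    case 0
    then have I: "I N m" by simp
    from stop[OF I] have "exec (While b c) m 1 m" by (rule WhileFalse)
    then show ?case using I unfolding runs_def by (intro exI[of _ 1] exI[of _ m]) simp
  next
    case (Suc k)
    have "N - Suc k < N" "Suc (N - Suc k) = N - k" using Suc.prems by auto
    then obtain t1 m1 where 1: "testval m b True" "exec c m t1 m1" "t1 \<le> T" "I (N - k) m1"
      using step[of "N - Suc k" m] Suc.prems by (auto simp: runs_def)
    then obtain t2 m2 where 2: "exec (While b c) m1 t2 m2" "t2 \<le> k * (T + 1) + 1" "I N m2"
      using Suc.IH[of m1] Suc.prems by (auto simp: runs_def)
    have "exec (While b c) m (1 + t1 + t2) m2" by (rule WhileTrue[OF 1(1,2) 2(1)])
    moreover have "1 + t1 + t2 \<le> Suc k * (T + 1) + 1" using 1 2 by simp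
    ultimately show ?case using 2 unfolding runs_def by blast
  qed
  from this[of N] assms(1) show ?thesis by simp
qed

lemma testval_LessEq:
  assumes "opval m a = Some u" "opval m b = Some v" "w \<longleftrightarrow> u \<le> v"
  shows "testval m (LessEq a b) w"
  unfolding assms(3) by (rule testval.intros(2)[OF assms(1,2)])

section \<open>The program\<close>

text \<open>
  The program computes a table \<open>P\<close> of partition numbers up to \<open>L = n - 4\<close>, admitting the parts
  1, 2, and so on one after the other. When the part \<open>k\<close> is admitted, the table is updated in place from
  left to right by \<open>P[i] := P[i] + P[i - k]\<close>, so \<open>P[i - k]\<close> already counts partitions that may use \<open>k\<close>.
  Finally every second entry, from \<open>P[n - 4]\<close> downwards, is subtracted from \<open>d\<close>; stepping down from
  \<open>n - 4\<close> gets the parity right without any division. For \<open>n < 4\<close> no loop is entered.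
\<close>

definition init_body :: com where
  "init_body = Seq (Store ''P'' (Var ''i'') (Const 0)) (Add ''i'' (Var ''i'') (Const 1))"

definition update_body :: com where
  "update_body =
     Seq (Sub ''j'' (Var ''i'') (Var ''k''))
    (Seq (Load ''a'' ''P'' (Var ''j''))
    (Seq (Load ''b'' ''P'' (Var ''i''))
    (Seq (Add ''a'' (Var ''a'') (Var ''b''))
    (Seq (Store ''P'' (Var ''i'') (Var ''a''))
         (Add ''i'' (Var ''i'') (Const 1))))))"

definition part_body :: com where
  "part_body =
     Seq (Copy ''i'' (Var ''k''))
    (Seq (While (LessEq (Var ''i'') (Var ''L'')) update_body)
         (Add ''k'' (Var ''k'') (Const 1)))"

definition collect_body :: com where
  "collect_body =
     Seq (Load ''a'' ''P'' (Var ''i''))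
    (Seq (Sub ''result'' (Var ''result'') (Var ''a''))
         (Sub ''i'' (Var ''i'') (Const 2)))"

definition prologue :: com where
  "prologue =
     Seq (Copy ''result'' (Var ''d''))
    (Seq (Sub ''L'' (Var ''n'') (Const 4))
    (Seq (Store ''P'' (Const 0) (Const 1))
         (Copy ''i'' (Const 1))))"

definition program :: com where
  "program =
     Seq prologue
    (Seq (While (LessEq (Var ''i'') (Var ''L'')) init_body)
    (Seq (Copy ''k'' (Const 1))
    (Seq (While (LessEq (Var ''k'') (Var ''L'')) part_body)
    (Seq (Copy ''i'' (Var ''L''))
         (While (LessEq (Const 0) (Var ''i'')) collect_body)))))"

definition cells :: "nat \<Rightarrow> cell set" where
  "cells n = Scalar ` {''n'', ''d'', ''L'', ''result'', ''i'', ''k'', ''j'', ''a'', ''b''} \<union>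
     Elem ''P'' ` {..n - 4}"

text \<open>
  The array contains \<open>f 0, \<dots>, f l\<close> and nothing else. The index \<open>n - 4\<close> is truncated, which is right for
  \<open>n < 4\<close>: then only the entry 0 is written, while the scalar \<open>L\<close> is negative.
\<close>

definition memory_holds :: "nat \<Rightarrow> int \<Rightarrow> nat \<Rightarrow> (nat \<Rightarrow> nat) \<Rightarrow> mem \<Rightarrow> bool" where
  "memory_holds n v l f m \<longleftrightarrow> l \<le> n - 4 \<and> m (Scalar ''L'') = Some (int n - 4) \<and>
     m (Scalar ''result'') = Some v \<and>
     (\<forall>x. m (Elem ''P'' x) = (if x \<le> l then Some (int (f x)) else None)) \<and> dom m \<subseteq> cells n"

lemma memory_holds_upd_scalar:
  assumes "memory_holds n v l f m" "x \<in> {''i'', ''k'', ''j'', ''a'', ''b''}"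
  shows "memory_holds n v l f (m(Scalar x \<mapsto> u))"
proof -
  have "Scalar x \<in> cells n" using assms(2) by (auto simp: cells_def)
  then show ?thesis using assms unfolding memory_holds_def by auto
qed

lemma memory_holds_upd_result:
  assumes "memory_holds n v l f m" shows "memory_holds n w l f (m(Scalar ''result'' \<mapsto> w))"
proof -
  have "Scalar ''result'' \<in> cells n" by (simp add: cells_def)
  then show ?thesis using assms unfolding memory_holds_def by simp
qed

lemma memory_holds_upd_elem:
  assumes "memory_holds n v l f m" "x \<le> l" "f' = f(x := y)"
  shows "memory_holds n v l f' (m(Elem ''P'' x \<mapsto> int y))"
proof -
  have "Elem ''P'' x \<in> cells n" using assms by (simp add: cells_def memory_holds_def)
  then show ?thesis using assms unfolding memory_holds_def by simp
qed

lemma memory_holds_append: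
  assumes "memory_holds n v l f m" "l < n - 4" "f (Suc l) = y"
  shows "memory_holds n v (Suc l) f (m(Elem ''P'' (Suc l) \<mapsto> int y))"
proof -
  have "Elem ''P'' (Suc l) \<in> cells n" using assms by (simp add: cells_def)
  then show ?thesis using assms unfolding memory_holds_def by auto
qed

lemma runs_prologue:
  "runs prologue (input n d) 4
     (\<lambda>m. memory_holds n (int d) 0 (\<lambda>x. num_partitions x 0) m \<and> m (Scalar ''i'') = Some 1)"
proof (rule runs_straight)
  show "straight prologue (input n d) = Some (4, (input n d)(Scalar ''result'' \<mapsto> int d,
      Scalar ''L'' \<mapsto> int n - 4, Elem ''P'' 0 \<mapsto> 1, Scalar ''i'' \<mapsto> 1))"
    by (simp add: prologue_def input_def)
qed (auto simp: input_def memory_holds_def cells_def num_partitions_0)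

lemma runs_init:
  assumes "memory_holds n v 0 (\<lambda>x. num_partitions x 0) m" "m (Scalar ''i'') = Some 1"
  shows "runs (While (LessEq (Var ''i'') (Var ''L'')) init_body) m ((n - 4) * 3 + 1)
    (memory_holds n v (n - 4) (\<lambda>x. num_partitions x 0))"
proof -
  let ?I = "\<lambda>t m. memory_holds n v t (\<lambda>x. num_partitions x 0) m \<and> m (Scalar ''i'') = Some (int t + 1)"
  have "runs (While (LessEq (Var ''i'') (Var ''L'')) init_body) m ((n - 4) * (2 + 1) + 1) (?I (n - 4))"
  proof (rule runs_While[where I = ?I])
    show "?I 0 m" using assms by simp
    show "testval m (LessEq (Var ''i'') (Var ''L'')) True \<and> runs init_body m 2 (?I (Suc t))"
      if t: "t < n - 4" and I: "?I t m" for t m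
    proof
      show "testval m (LessEq (Var ''i'') (Var ''L'')) True"
        by (rule testval_LessEq) (use t I in \<open>auto simp: memory_holds_def\<close>)
      have "nat (int t + 1) = Suc t" by simp
      then have "straight init_body m =
          Some (2, m(Elem ''P'' (Suc t) \<mapsto> 0, Scalar ''i'' \<mapsto> int t + 2))"
        using I by (auto simp: init_body_def memory_holds_def)
      moreover have "memory_holds n v (Suc t) (\<lambda>x. num_partitions x 0) (m(Elem ''P'' (Suc t) \<mapsto> 0))"
        using memory_holds_append[of n v t _ m 0] I t by (simp add: num_partitions_0)
      ultimately show "runs init_body m 2 (?I (Suc t))"
        by (intro runs_straight) (auto intro!: memory_holds_upd_scalar)
    qed
    show "testval m (LessEq (Var ''i'') (Var ''L'')) False" if "?I (n - 4) m" for m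
      by (rule testval_LessEq) (use that in \<open>auto simp: memory_holds_def\<close>)
  qed
  then show ?thesis by (rule runs_mono) simp_all
qed

text \<open>
  The table while the part \<open>Suc k\<close> is being admitted, with the entries below \<open>l\<close> already updated.
\<close>

definition mixed :: "nat \<Rightarrow> nat \<Rightarrow> nat \<Rightarrow> nat" where
  "mixed k l x = (if x < l then num_partitions x (Suc k) else num_partitions x k)"

lemma mixed_Suc:
  assumes "Suc k \<le> i"
  shows "(mixed k i)(i := num_partitions (i - Suc k) (Suc k) + num_partitions i k) = mixed k (Suc i)"
proof
  fix x
  consider "x = i" | "x < i" | "i < x" by linarith
  then show "((mixed k i)(i := num_partitions (i - Suc k) (Suc k) + num_partitions i k)) x = mixed k (Suc i) x"
  proof cases
    case 1
    then show ?thesis using assms num_partitions_Suc[of i k] by (simp add: mixed_def)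
  qed (simp_all add: mixed_def)
qed

lemma runs_update:
  assumes k: "k < n - 4" and H: "memory_holds n v (n - 4) (\<lambda>x. num_partitions x k) m"
    and m: "m (Scalar ''i'') = Some (int k + 1)" "m (Scalar ''k'') = Some (int k + 1)"
  shows "runs (While (LessEq (Var ''i'') (Var ''L'')) update_body) m ((n - 4) * 7 + 1)
    (\<lambda>m. memory_holds n v (n - 4) (\<lambda>x. num_partitions x (Suc k)) m \<and> m (Scalar ''k'') = Some (int k + 1))"
proof -
  let ?I = "\<lambda>t m. memory_holds n v (n - 4) (mixed k (Suc (k + t))) m \<and>
    m (Scalar ''i'') = Some (int (Suc (k + t))) \<and> m (Scalar ''k'') = Some (int k + 1)"
  let ?N = "n - 4 - k"
  have "runs (While (LessEq (Var ''i'') (Var ''L'')) update_body) m (?N * (6 + 1) + 1) (?I ?N)"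
  proof (rule runs_While[where I = ?I])
    have "mixed k (Suc k) = (\<lambda>x. num_partitions x k)"
      by (auto simp: mixed_def num_partitions_Suc)
    then show "?I 0 m" using H m by simp
    show "testval m (LessEq (Var ''i'') (Var ''L'')) True \<and> runs update_body m 6 (?I (Suc t))"
      if t: "t < ?N" and I: "?I t m" for t m
    proof
      show "testval m (LessEq (Var ''i'') (Var ''L'')) True"
        by (rule testval_LessEq) (use t I in \<open>auto simp: memory_holds_def\<close>)
      let ?i = "Suc (k + t)" and ?a = "num_partitions t (Suc k)" and ?b = "num_partitions (Suc (k + t)) k"
      have P: "m (Elem ''P'' x) = Some (int (mixed k ?i x))" if "x \<le> n - 4" for x
        using I that by (simp add: memory_holds_def)
      have at: "m (Elem ''P'' t) = Some (int ?a)" "m (Elem ''P'' ?i) = Some (int ?b)"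
        using t by (simp_all add: P mixed_def)
      have eq: "int (Suc (k + t)) - (int k + 1) = int t" "int (Suc (k + t)) + 1 = int (Suc ?i)" by simp_all
      have "straight update_body m = Some (6, m(Scalar ''j'' \<mapsto> int t, Scalar ''a'' \<mapsto> int ?a,
          Scalar ''b'' \<mapsto> int ?b, Scalar ''a'' \<mapsto> int ?a + int ?b, Elem ''P'' ?i \<mapsto> int ?a + int ?b,
          Scalar ''i'' \<mapsto> int (Suc ?i)))"
        using I at t P by (simp add: update_body_def eq del: of_nat_Suc)
      moreover have "mixed k (Suc ?i) = (mixed k ?i)(?i := ?a + ?b)"
        using mixed_Suc[of k ?i] by simp
      then have "memory_holds n v (n - 4) (mixed k (Suc ?i)) (m(Scalar ''j'' \<mapsto> int t, Scalar ''a'' \<mapsto> int ?a,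
          Scalar ''b'' \<mapsto> int ?b, Scalar ''a'' \<mapsto> int ?a + int ?b, Elem ''P'' ?i \<mapsto> int (?a + ?b)))"
        using I t by (intro memory_holds_upd_elem memory_holds_upd_scalar) auto
      ultimately show "runs update_body m 6 (?I (Suc t))"
        using I by (intro runs_straight) (auto intro!: memory_holds_upd_scalar)
    qed
    show "testval m (LessEq (Var ''i'') (Var ''L'')) False" if "?I ?N m" for m
      by (rule testval_LessEq) (use that k in \<open>auto simp: memory_holds_def\<close>)
  qed
  then show ?thesis
  proof (rule runs_mono)
    show "memory_holds n v (n - 4) (\<lambda>x. num_partitions x (Suc k)) m \<and> m (Scalar ''k'') = Some (int k + 1)"
      if "?I ?N m" for m
      using that k by (auto simp: memory_holds_def mixed_def)
  qed simp
qed

lemma runs_part_body: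
  assumes k: "k < n - 4" and H: "memory_holds n v (n - 4) (\<lambda>x. num_partitions x k) m"
    and m: "m (Scalar ''k'') = Some (int k + 1)"
  shows "runs part_body m ((n - 4) * 7 + 3)
    (\<lambda>m. memory_holds n v (n - 4) (\<lambda>x. num_partitions x (Suc k)) m \<and> m (Scalar ''k'') = Some (int (Suc k) + 1))"
proof -
  let ?A = "\<lambda>m. memory_holds n v (n - 4) (\<lambda>x. num_partitions x k) m \<and>
    m (Scalar ''i'') = Some (int k + 1) \<and> m (Scalar ''k'') = Some (int k + 1)"
  let ?B = "\<lambda>m. memory_holds n v (n - 4) (\<lambda>x. num_partitions x (Suc k)) m \<and>
    m (Scalar ''k'') = Some (int k + 1)"
  let ?C = "\<lambda>m. memory_holds n v (n - 4) (\<lambda>x. num_partitions x (Suc k)) m \<and>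
    m (Scalar ''k'') = Some (int (Suc k) + 1)"
  have "runs part_body m (1 + (((n - 4) * 7 + 1) + 1)) ?C"
    unfolding part_body_def
  proof (rule runs_Seq[where R = ?A])
    show "runs (Copy ''i'' (Var ''k'')) m 1 ?A"
      by (rule runs_straight) (use H m in \<open>auto intro!: memory_holds_upd_scalar\<close>)
    show "runs (Seq (While (LessEq (Var ''i'') (Var ''L'')) update_body)
        (Add ''k'' (Var ''k'') (Const 1))) m1 ((n - 4) * 7 + 1 + 1) ?C" if "?A m1" for m1
    proof (rule runs_Seq)
      show "runs (While (LessEq (Var ''i'') (Var ''L'')) update_body) m1 ((n - 4) * 7 + 1) ?B"
        using that by (intro runs_update[OF k]) auto
      show "runs (Add ''k'' (Var ''k'') (Const 1)) m2 1 ?C" if "?B m2" for m2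
        by (rule runs_straight) (use that in \<open>auto intro!: memory_holds_upd_scalar\<close>)
    qed
  qed
  then show ?thesis by (rule runs_mono) simp_all
qed

lemma runs_parts:
  assumes H: "memory_holds n v (n - 4) (\<lambda>x. num_partitions x 0) m" and m: "m (Scalar ''k'') = Some 1"
  shows "runs (While (LessEq (Var ''k'') (Var ''L'')) part_body) m ((n - 4) * ((n - 4) * 7 + 4) + 1)
    (memory_holds n v (n - 4) (\<lambda>x. num_partitions x (n - 4)))"
proof -
  let ?I = "\<lambda>k m. memory_holds n v (n - 4) (\<lambda>x. num_partitions x k) m \<and> m (Scalar ''k'') = Some (int k + 1)"
  have "runs (While (LessEq (Var ''k'') (Var ''L'')) part_body) m
      ((n - 4) * (((n - 4) * 7 + 3) + 1) + 1) (?I (n - 4))"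
  proof (rule runs_While[where I = ?I])
    show "?I 0 m" using assms by simp
    show "testval m (LessEq (Var ''k'') (Var ''L'')) True \<and> runs part_body m ((n - 4) * 7 + 3) (?I (Suc k))"
      if k: "k < n - 4" and I: "?I k m" for k m
    proof
      show "testval m (LessEq (Var ''k'') (Var ''L'')) True"
        by (rule testval_LessEq) (use k I in \<open>auto simp: memory_holds_def\<close>)
      show "runs part_body m ((n - 4) * 7 + 3) (?I (Suc k))"
        using I by (intro runs_part_body[OF k]) auto
    qed
    show "testval m (LessEq (Var ''k'') (Var ''L'')) False" if "?I (n - 4) m" for m
      by (rule testval_LessEq) (use that in \<open>auto simp: memory_holds_def\<close>)
  qed
  then show ?thesis by (rule runs_mono) (simp_all add: algebra_simps)
qed

lemma runs_collect:
  assumes H: "memory_holds n v (n - 4) f m" and m: "m (Scalar ''i'') = Some (int n - 4)"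
  shows "runs (While (LessEq (Const 0) (Var ''i'')) collect_body) m ((n - 2) div 2 * 4 + 1)
    (memory_holds n (v - (\<Sum>t<(n - 2) div 2. int (f (n - 4 - 2 * t)))) (n - 4) f)"
proof -
  let ?I = "\<lambda>t m. memory_holds n (v - (\<Sum>u<t. int (f (n - 4 - 2 * u)))) (n - 4) f m \<and>
    m (Scalar ''i'') = Some (int n - 4 - 2 * int t)"
  let ?N = "(n - 2) div 2"
  have "runs (While (LessEq (Const 0) (Var ''i'')) collect_body) m (?N * (3 + 1) + 1) (?I ?N)"
  proof (rule runs_While[where I = ?I])
    show "?I 0 m" using assms by simp
    show "testval m (LessEq (Const 0) (Var ''i'')) True \<and> runs collect_body m 3 (?I (Suc t))"
      if t: "t < ?N" and I: "?I t m" for t m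
    proof
      have ge: "0 \<le> int n - 4 - 2 * int t" using t by linarith
      show "testval m (LessEq (Const 0) (Var ''i'')) True"
        by (rule testval_LessEq[where u = 0 and v = "int n - 4 - 2 * int t"]) (use ge I in simp_all)
      let ?x = "n - 4 - 2 * t"
      have nat: "nat (int n - 4 - 2 * int t) = ?x" using ge by linarith
      have at: "m (Elem ''P'' ?x) = Some (int (f ?x))" using I by (simp add: memory_holds_def)
      have "straight collect_body m = Some (3, m(Scalar ''a'' \<mapsto> int (f ?x),
          Scalar ''result'' \<mapsto> v - (\<Sum>u<t. int (f (n - 4 - 2 * u))) - int (f ?x),
          Scalar ''i'' \<mapsto> int n - 4 - 2 * int t - 2))"
        using I ge by (simp add: collect_body_def memory_holds_def nat)
      then show "runs collect_body m 3 (?I (Suc t))"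
      proof (rule runs_straight)
        have "v - (\<Sum>u<t. int (f (n - 4 - 2 * u))) - int (f ?x) =
            v - (\<Sum>u<Suc t. int (f (n - 4 - 2 * u)))" by simp
        then show "?I (Suc t) (m(Scalar ''a'' \<mapsto> int (f ?x),
          Scalar ''result'' \<mapsto> v - (\<Sum>u<t. int (f (n - 4 - 2 * u))) - int (f ?x),
          Scalar ''i'' \<mapsto> int n - 4 - 2 * int t - 2))"
          using I by (simp only:) (auto intro!: memory_holds_upd_scalar memory_holds_upd_result)
      qed
    qed
    show "testval m (LessEq (Const 0) (Var ''i'')) False" if "?I ?N m" for m
    proof (rule testval_LessEq)
      have "n < 2 * ?N + 4" by linarith
      then have "int n < 2 * int ?N + 4" by linarith
      then show "False \<longleftrightarrow> 0 \<le> int n - 4 - 2 * int ?N" by simp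
    qed (use that in auto)
  qed
  then show ?thesis by (rule runs_mono) simp_all
qed

text \<open>
  The summands follow the phases of the program; only the second loop is quadratic.
\<close>

definition time_bound :: "nat \<Rightarrow> nat" where
  "time_bound n = 4 + (((n - 4) * 3 + 1) + (1 + (((n - 4) * ((n - 4) * 7 + 4) + 1) +
     (1 + ((n - 2) div 2 * 4 + 1)))))"

text \<open>
  The indices \<open>n - 4, n - 6, \<dots>\<close> visited by the last loop are the numbers \<open>m\<close> of the right parity.
  Partitions of \<open>m\<close> have no parts above \<open>n - 4\<close>, so the final table contains all of them.
\<close>

lemma card_sparse_seqs_loop:
  "card (sparse_seqs n) = (\<Sum>t<(n - 2) div 2. num_partitions (n - 4 - 2 * t) (n - 4))"
proof -
  have "(\<Sum>m | m + 4 \<le> n \<and> even (m + n). num_partitions m m) =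
      (\<Sum>t<(n - 2) div 2. num_partitions (n - 4 - 2 * t) (n - 4))"
  proof (rule sum.reindex_bij_witness[of _ "\<lambda>t. n - 4 - 2 * t" "\<lambda>m. (n - 4 - m) div 2"])
    fix m assume m: "m \<in> {m. m + 4 \<le> n \<and> even (m + n)}"
    then obtain j where j: "n = m + 4 + j" using le_iff_add by auto
    with m have "even j" by auto
    then obtain t where t: "n = m + 4 + 2 * t" using j by (auto elim: evenE)
    show inv: "n - 4 - 2 * ((n - 4 - m) div 2) = m" and "(n - 4 - m) div 2 \<in> {..<(n - 2) div 2}"
      by (simp_all add: t)
    have "bounded_partitions m (n - 4) = bounded_partitions m m"
      by (rule bounded_partitions_saturate) (simp add: t)
    then show "num_partitions (n - 4 - 2 * ((n - 4 - m) div 2)) (n - 4) = num_partitions m m"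
      unfolding inv by (simp add: num_partitions_def)
  next
    fix t assume "t \<in> {..<(n - 2) div 2}"
    then have "2 * t + 4 \<le> n" by auto
    then obtain m where "n = 2 * t + 4 + m" using le_iff_add by auto
    then show "(n - 4 - (n - 4 - 2 * t)) div 2 = t" "n - 4 - 2 * t \<in> {m. m + 4 \<le> n \<and> even (m + n)}"
      by auto
  qed
  then show ?thesis by (simp add: card_sparse_seqs)
qed

lemma runs_program:
  "runs program (input n d) (time_bound n)
     (\<lambda>m. m (Scalar ''result'') = Some (int d - int (card (sparse_seqs n))) \<and> dom m \<subseteq> cells n)"
proof -
  let ?f = "\<lambda>k x. num_partitions x k"
  let ?R1 = "\<lambda>m. memory_holds n (int d) 0 (?f 0) m \<and> m (Scalar ''i'') = Some 1"
  let ?R2 = "memory_holds n (int d) (n - 4) (?f 0)"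
  let ?R3 = "\<lambda>m. ?R2 m \<and> m (Scalar ''k'') = Some 1"
  let ?R4 = "memory_holds n (int d) (n - 4) (?f (n - 4))"
  let ?R5 = "\<lambda>m. ?R4 m \<and> m (Scalar ''i'') = Some (int n - 4)"
  let ?Q = "\<lambda>m. m (Scalar ''result'') = Some (int d - int (card (sparse_seqs n))) \<and> dom m \<subseteq> cells n"
  have init: "runs (While (LessEq (Var ''i'') (Var ''L'')) init_body) m ((n - 4) * 3 + 1) ?R2"
    if "?R1 m" for m
    using that by (intro runs_init) auto
  have first_part: "runs (Copy ''k'' (Const 1)) m 1 ?R3" if "?R2 m" for m
    by (rule runs_straight) (use that in \<open>auto intro!: memory_holds_upd_scalar\<close>)
  have parts: "runs (While (LessEq (Var ''k'') (Var ''L'')) part_body) m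
      ((n - 4) * ((n - 4) * 7 + 4) + 1) ?R4" if "?R3 m" for m
    using that by (intro runs_parts) auto
  have last_index: "runs (Copy ''i'' (Var ''L'')) m 1 ?R5" if "?R4 m" for m
  proof (rule runs_straight)
    show "straight (Copy ''i'' (Var ''L'')) m = Some (1, m(Scalar ''i'' \<mapsto> int n - 4))"
      using that by (simp add: memory_holds_def)
  qed (use that in \<open>auto intro!: memory_holds_upd_scalar\<close>)
  have collect: "runs (While (LessEq (Const 0) (Var ''i'')) collect_body) m
      ((n - 2) div 2 * 4 + 1) ?Q" if "?R5 m" for m
  proof (rule runs_mono)
    show "runs (While (LessEq (Const 0) (Var ''i'')) collect_body) m ((n - 2) div 2 * 4 + 1)
        (memory_holds n (int d - (\<Sum>t<(n - 2) div 2. int (?f (n - 4) (n - 4 - 2 * t)))) (n - 4) (?f (n - 4)))"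
      using that by (intro runs_collect) auto
  qed (auto simp: memory_holds_def card_sparse_seqs_loop)
  show ?thesis
    unfolding program_def time_bound_def
    by (rule runs_Seq[where R = ?R1, OF runs_prologue],
        rule runs_Seq[where R = ?R2, OF init], assumption,
        rule runs_Seq[where R = ?R3, OF first_part], assumption,
        rule runs_Seq[where R = ?R4, OF parts], assumption,
        rule runs_Seq[where R = ?R5, OF last_index], assumption,
        rule collect)
qed

lemma time_bound_le:
  assumes "1 \<le> n" shows "time_bound n \<le> 30 * n ^ 3"
proof -
  have "(n - 4) * ((n - 4) * 7 + 4) \<le> n * (n * 7 + 4)" by (intro mult_mono) auto
  moreover have "n \<le> n ^ 3" "n * n \<le> n ^ 3" "1 \<le> n ^ 3"
    using assms power_increasing[of 1 3 n] power_increasing[of 2 3 n] by (simp_all add: power2_eq_square)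
  ultimately show ?thesis unfolding time_bound_def by (simp add: algebra_simps)
qed

lemma card_cells_le:
  assumes "1 \<le> n" shows "finite (cells n)" "card (cells n) \<le> 11 * n ^ 3"
proof -
  show "finite (cells n)" by (simp add: cells_def)
  have "card (cells n) \<le> 9 + (n + 1)"
    unfolding cells_def
    by (intro order_trans[OF card_Un_le] add_mono order_trans[OF card_image_le]) auto
  moreover have "n \<le> n ^ 3" using assms power_increasing[of 1 3 n] by simp
  ultimately show "card (cells n) \<le> 11 * n ^ 3" using assms by linarith
qed

lemma computes_program:
  assumes "1 \<le> n"
  shows "\<exists>t s. computes program (input n (card (D n))) (int (card (Dc n))) t s \<and>
    t \<le> 30 * n ^ 3 \<and> s \<le> 11 * n ^ 3"
proof -
  obtain t m where "exec program (input n (card (D n))) t m" "t \<le> time_bound n"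
    "m (Scalar ''result'') = Some (int (card (D n)) - int (card (sparse_seqs n)))" "dom m \<subseteq> cells n"
    using runs_program[of n "card (D n)"] by (auto simp: runs_def)
  moreover from this have "card (dom m) \<le> 11 * n ^ 3"
    using card_cells_le(2)[OF assms] card_mono[OF card_cells_le(1)[OF assms], of "dom m"]
    by linarith
  ultimately show ?thesis
    using time_bound_le[OF assms] card_Dc[OF assms] unfolding computes_def
    by (intro exI[of _ t] exI[of _ "card (dom m)"] conjI exI[of _ m]) simp_all
qed

theorem mainTheorem4:
  shows "(\<forall>n::nat. 1 \<le> n \<longrightarrow>
            int (card (Dc n)) =
              int (card (D n)) -
              (\<Sum>N | int n \<le> N \<and> N < 2 * (int n - 1) \<and> even N.
                 \<Sum>k = 1..int n - 1.
                   int (card (P4 (N - k - int n + 1) (k - 1) (int n - 1) (int n - k - 1))))) \<and>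
         (\<exists>(c::com) (time::nat \<Rightarrow> nat) (space::nat \<Rightarrow> nat).
            (\<forall>n::nat. 1 \<le> n \<longrightarrow>
               computes c (input n (card (D n))) (int (card (Dc n))) (time n) (space n)) \<and>
            (\<lambda>n. real (time n)) \<in> O(\<lambda>n. real n ^ 3) \<and>
            (\<lambda>n. real (space n)) \<in> O(\<lambda>n. real n ^ 3))"
proof (intro conjI)
  show "\<forall>n::nat. 1 \<le> n \<longrightarrow> int (card (Dc n)) = int (card (D n)) -
      (\<Sum>N | int n \<le> N \<and> N < 2 * (int n - 1) \<and> even N.
         \<Sum>k = 1..int n - 1.
           int (card (P4 (N - k - int n + 1) (k - 1) (int n - 1) (int n - k - 1))))"
    using card_Dc by (simp only: sum_P4_eq_card_sparse_seqs) simp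
  obtain time space :: "nat \<Rightarrow> nat" where ts: "\<And>n. 1 \<le> n \<Longrightarrow>
      computes program (input n (card (D n))) (int (card (Dc n))) (time n) (space n) \<and>
      time n \<le> 30 * n ^ 3 \<and> space n \<le> 11 * n ^ 3"
    using computes_program by metis
  have big: "(\<lambda>n. real (f n)) \<in> O(\<lambda>n. real n ^ 3)"
    if "\<And>n. 1 \<le> n \<Longrightarrow> f n \<le> b * n ^ 3" for f :: "nat \<Rightarrow> nat" and b :: nat
  proof (rule bigoI)
    have "real (f n) \<le> real b * real n ^ 3" if "1 \<le> n" for n
      using \<open>\<And>n. 1 \<le> n \<Longrightarrow> f n \<le> b * n ^ 3\<close>[OF that]
      by (metis of_nat_le_iff of_nat_mult of_nat_power)
    then show "\<forall>\<^sub>F n in sequentially. norm (real (f n)) \<le> real b * norm (real n ^ 3)"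
      by (intro eventually_sequentiallyI[of 1]) simp
  qed
  show "\<exists>(c::com) (time::nat \<Rightarrow> nat) (space::nat \<Rightarrow> nat).
            (\<forall>n::nat. 1 \<le> n \<longrightarrow>
               computes c (input n (card (D n))) (int (card (Dc n))) (time n) (space n)) \<and>
            (\<lambda>n. real (time n)) \<in> O(\<lambda>n. real n ^ 3) \<and>
            (\<lambda>n. real (space n)) \<in> O(\<lambda>n. real n ^ 3)"
    using ts big[of time 30] big[of space 11] by blast
qed

end
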